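(* Consider diffusive deposition started from the empty configuration $\sigma(0)=(0,\dots,0)$. There exist constants $0<\alpha<\beta$ and $\chi>0$ such that, with probability at least $1-\varepsilon_N$ where $\sum_N\varepsilon_N<\infty$ (in the paper's words: almost surely, for all $N$ large enough), $$\max_{i\in G_N}\sigma_i\Big(\Big\lfloor\frac{\alpha N}{\log N}\Big\rfloor\Big)\le 3\log N \quad\text{and}\quad \max_{i\in G_N}\sigma_i\Big(\Big\lfloor\frac{\beta N}{\log N}\Big\rfloor\Big)\ge N^{\chi}.$$
   Context: Deposition models. Fix an integer $N\ge2$ and let $G_N=\{1,\dots,N\}$. A configuration is $\sigma=(\sigma_1,\dots,\sigma_N)\in\mathbb N^N$ ($\mathbb N=\{0,1,2,\dots\}$), $\sigma_i$ being the height of column (pile) $i$; the corresponding cluster is $\bigcup_i\{i\}\times\{0,\dots,\sigma_i\}\subset G_N\times\mathbb N$ (so the ground $G_N\times\{0\}$ always belongs to it). Write $|\sigma|=\sum_i\sigma_i$. Given the current configuration $\sigma$, an explorer is a walk $S_n=(X_n,Z_n)$, $n\ge0$, where $(X_n)_{n\ge0}$ are i.i.d. uniform on $G_N$, $Z_0=\max_i\sigma_i+1$, and for diffusive deposition $(Z_{n+1}-Z_n)_{n\ge0}$ are i.i.d. uniform on $\{-1,+1\}$ independent of $(X_n)$, while for ballistic deposition $Z_{n+1}-Z_n=-1$ for all $n$. Let $n^*=\inf\{n\ge0:Z_n\le\sigma_{X_n}\}$ and $(X^*,Z^* )=(X_{n^*},Z_{n^*})$ (the hitting site); the explorer attaches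 to column $X^*$, i.e. the new configuration is $\sigma+e_{X^*}$. Explorers are sent one at a time, independently, and $\sigma(t)$ denotes the configuration after $t$ explorers have been sent. *)

theory Defs
  imports "HOL-Probability.Probability"
begin

(* Configurations: sigma :: nat => nat, sigma i = height of column i, for i in {1..N}
   (values outside {1..N} are irrelevant and stay 0). *)

definition height_max :: "nat \<Rightarrow> (nat \<Rightarrow> nat) \<Rightarrow> nat" where
  "height_max N \<sigma> = Max (\<sigma> ` {1..N})"

definition step_law :: "nat \<Rightarrow> (nat \<times> int) measure" where
  "step_law N = measure_pmf (pair_pmf (pmf_of_set {1..N}) (pmf_of_set {-1, 1::int}))"

(* Randomness of one explorer: i.i.d. sequence of (X_n, Z_{n+1}-Z_n). *)
definition explorer_law :: "nat \<Rightarrow> (nat \<times> int) stream measure" where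
  "explorer_law N = stream_space (step_law N)"

(* Randomness of the whole process: explorers independent, explorer t uses the t-th stream. *)
definition deposition_space :: "nat \<Rightarrow> (nat \<times> int) stream stream measure" where
  "deposition_space N = stream_space (explorer_law N)"

definition expl_X :: "(nat \<times> int) stream \<Rightarrow> nat \<Rightarrow> nat" where
  "expl_X w n = fst (w !! n)"

definition expl_Z :: "nat \<Rightarrow> (nat \<Rightarrow> nat) \<Rightarrow> (nat \<times> int) stream \<Rightarrow> nat \<Rightarrow> int" where
  "expl_Z N \<sigma> w n = int (height_max N \<sigma>) + 1 + (\<Sum>k<n. snd (w !! k))"

definition hit_time :: "nat \<Rightarrow> (nat \<Rightarrow> nat) \<Rightarrow> (nat \<times> int) stream \<Rightarrow> nat" where
  "hit_time N \<sigma> w = (LEAST n. expl_Z N \<sigma> w n \<le> int (\<sigma> (expl_X w n)))"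

definition hit_col :: "nat \<Rightarrow> (nat \<Rightarrow> nat) \<Rightarrow> (nat \<times> int) stream \<Rightarrow> nat" where
  "hit_col N \<sigma> w = expl_X w (hit_time N \<sigma> w)"

definition deposit :: "nat \<Rightarrow> (nat \<Rightarrow> nat) \<Rightarrow> (nat \<times> int) stream \<Rightarrow> (nat \<Rightarrow> nat)" where
  "deposit N \<sigma> w = \<sigma>(hit_col N \<sigma> w := Suc (\<sigma> (hit_col N \<sigma> w)))"

primrec config :: "nat \<Rightarrow> nat \<Rightarrow> (nat \<times> int) stream stream \<Rightarrow> (nat \<Rightarrow> nat)" where
  "config N 0 \<omega> = (\<lambda>_. 0)"
| "config N (Suc t) \<omega> = deposit N (config N t \<omega>) (\<omega> !! t)"

end

theory Submission
  imports Defs "HOL-Real_Asymp.Real_Asymp"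
begin

text \<open>
  Given a configuration, the height of an explorer is a simple random walk killed at height \<open>z\<close> with the
  proportion of columns of height at least \<open>z\<close>. Comparing discrete harmonic functions with the free walk
  killed at the ground shows that a column of height \<open>k\<close> grows with probability at most
  \<open>(1 + k (k + 1)) / N\<close>, and at least half of that as long as \<open>\<Sum>\<^sub>j \<sigma>\<^sub>j (\<sigma>\<^sub>j + 1) \<le> N / 2\<close>. A product over the
  columns of birth-chain probabilities is a supermartingale, so the columns can be treated as independent
  birth chains with quadratic rates. Such a chain reaches height \<open>K\<close> within \<open>N / (8 K)\<close> steps with
  probability at most \<open>exp (- K)\<close>, which keeps all columns below \<open>3 log N\<close> at first. Within
  \<open>\<beta> N / log N\<close> steps, \<open>\<beta>\<close> large, it first climbs to height of order \<open>log N\<close> with probability at least a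
  small negative power of \<open>N\<close> and then explodes, because the waiting times \<open>N / k\<^sup>2\<close> are summable; one of
  \<open>N\<close> chains does so. Finally, if all columns are below \<open>N\<^sup>\<chi>\<close> but \<open>\<Sum>\<^sub>j \<sigma>\<^sub>j (\<sigma>\<^sub>j + 1) > N / 2\<close>, then at
  least about \<open>N\<close> to the power \<open>1 - 2 \<chi>\<close> columns exceed a small multiple of \<open>log N\<close>, which the upper
  comparison rules out.
\<close>

section \<open>Capture probabilities of one explorer\<close>

text \<open>A maximum principle on the half-line. The positive part \<open>F\<close> of
  \<open>E\<close> is convex and vanishes at the ground; a convex function that once increases grows
  at least linearly from there, which the bound \<open>B\<close> forbids.\<close>

lemma bounded_subsolution_nonpos:
  fixes E c :: "nat \<Rightarrow> real"
  assumes bdd: "\<And>z. E z \<le> B" and E0: "E 0 \<le> 0"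
    and c: "\<And>z. 0 \<le> c z" "\<And>z. c z \<le> 1"
    and sub: "\<And>z. E (Suc z) \<le> c (Suc z) * ((E z + E (Suc (Suc z))) / 2)"
  shows "E z \<le> 0"
proof -
  define F where "F z = max 0 (E z)" for z
  have F0: "F 0 = 0" and Fnn: "0 \<le> F z" for z
    using E0 by (auto simp: F_def)
  have Fsub: "2 * F (Suc z) \<le> F z + F (Suc (Suc z))" for z
  proof -
    have "c (Suc z) * ((E z + E (Suc (Suc z))) / 2) \<le> c (Suc z) * ((F z + F (Suc (Suc z))) / 2)"
      by (intro mult_left_mono c) (auto simp: F_def)
    also have "\<dots> \<le> 1 * ((F z + F (Suc (Suc z))) / 2)"
      by (intro mult_right_mono c) (use Fnn in auto)
    finally show ?thesis
      using sub[of z] Fnn[of z] Fnn[of "Suc (Suc z)"] by (auto simp: F_def)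
  qed
  have incr: "F (Suc z) - F z \<le> F (Suc (z + n)) - F (z + n)" for z n
  proof (induction n)
    case (Suc n)
    then show ?case using Fsub[of "z + n"] by simp
  qed simp
  have flat: "F (Suc z) \<le> F z" for z
  proof (rule ccontr)
    assume "\<not> F (Suc z) \<le> F z"
    then have pos: "0 < F (Suc z) - F z" by simp
    have grow: "real n * (F (Suc z) - F z) \<le> F (z + n)" for n
    proof (induction n)
      case (Suc n)
      then show ?case using incr[of z n] by (simp add: algebra_simps)
    qed (use Fnn in simp)
    obtain n where "max 0 B < real n * (F (Suc z) - F z)"
      using reals_Archimedean3[OF pos] by blast
    moreover have "F (z + n) \<le> max 0 B"
      using bdd[of "z + n"] by (auto simp: F_def)
    ultimately show False using grow[of n] by linarith
  qed
  have "F z \<le> 0"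
  proof (induction z)
    case (Suc z)
    then show ?case using flat[of z] by linarith
  qed (simp add: F0)
  then show ?thesis by (simp add: F_def)
qed

text \<open>The starting height is free, so that first-step analysis stays within one family. In the
  existential form a walk that never stops is not caught, whereas \<open>LEAST\<close> would give it
  an unspecified column.\<close>

definition caught :: "(nat \<Rightarrow> nat) \<Rightarrow> nat set \<Rightarrow> int \<Rightarrow> (nat \<times> int) stream \<Rightarrow> bool" where
  "caught \<sigma> C z w \<longleftrightarrow> (\<exists>n. z + (\<Sum>k<n. snd (w !! k)) \<le> int (\<sigma> (fst (w !! n))) \<and> fst (w !! n) \<in> C \<and>
     (\<forall>m<n. \<not> z + (\<Sum>k<m. snd (w !! k)) \<le> int (\<sigma> (fst (w !! m)))))"

text \<open>An entry of the stream pairs the column at the current time with the increment after it,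
  so the head decides about stopping before its increment is applied.\<close>

lemma caught_Stream:
  "caught \<sigma> C z (s ## w) \<longleftrightarrow>
     (if z \<le> int (\<sigma> (fst s)) then fst s \<in> C else caught \<sigma> C (z + snd s) w)"
proof (cases "z \<le> int (\<sigma> (fst s))")
  case True
  show ?thesis
  proof
    assume "caught \<sigma> C z (s ## w)"
    then obtain n where n: "fst ((s ## w) !! n) \<in> C"
      "\<forall>m<n. \<not> z + (\<Sum>k<m. snd ((s ## w) !! k)) \<le> int (\<sigma> (fst ((s ## w) !! m)))"
      unfolding caught_def by blast
    then have "n = 0" using True by (cases n) auto
    then show "if z \<le> int (\<sigma> (fst s)) then fst s \<in> C else caught \<sigma> C (z + snd s) w"
      using n True by simp
  next
    assume "if z \<le> int (\<sigma> (fst s)) then fst s \<in> C else caught \<sigma> C (z + snd s) w"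
    then show "caught \<sigma> C z (s ## w)"
      unfolding caught_def using True by (intro exI[of _ 0]) simp
  qed
next
  case False
  have shift: "z + (\<Sum>k<Suc n. snd ((s ## w) !! k)) = z + snd s + (\<Sum>k<n. snd (w !! k))" for n
    by (simp add: sum.lessThan_Suc_shift del: sum.lessThan_Suc)
  have ex: "(\<exists>n. P n) \<longleftrightarrow> P 0 \<or> (\<exists>n. P (Suc n))" for P :: "nat \<Rightarrow> bool"
    by (metis nat.exhaust)
  have "caught \<sigma> C z (s ## w) \<longleftrightarrow> caught \<sigma> C (z + snd s) w"
    unfolding caught_def using False
    by (subst ex) (simp add: shift All_less_Suc2 del: sum.lessThan_Suc)
  then show ?thesis using False by simp
qed

context
  fixes N :: nat
  assumes N: "1 \<le> N"
begin

lemma set_step_pmf: "set_pmf (pair_pmf (pmf_of_set {1..N}) (pmf_of_set {-1, 1::int})) = {1..N} \<times> {-1, 1}"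
  using N by (simp add: set_pmf_of_set)

lemma pmf_step: "x \<in> {1..N} \<Longrightarrow> d \<in> {-1, 1} \<Longrightarrow>
    pmf (pair_pmf (pmf_of_set {1..N}) (pmf_of_set {-1, 1::int})) (x, d) = 1 / (2 * real N)"
  using N by (auto simp: pmf_pair pmf_of_set)

end

section \<open>Probability spaces and measurability for one explorer\<close>

lemma prob_space_step_law: "prob_space (step_law N)"
  unfolding step_law_def by (rule measure_pmf.prob_space_axioms)

lemma prob_space_explorer_law: "prob_space (explorer_law N)"
  unfolding explorer_law_def by (rule prob_space.prob_space_stream_space[OF prob_space_step_law])

lemma prob_space_deposition_space: "prob_space (deposition_space N)"
  unfolding deposition_space_def by (rule prob_space.prob_space_stream_space[OF prob_space_explorer_law])

lemma space_step_law [simp]: "space (step_law N) = UNIV"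
  by (simp add: step_law_def)

lemma space_explorer_law [simp]: "space (explorer_law N) = UNIV"
  by (simp add: explorer_law_def space_stream_space)

lemma space_deposition_space [simp]: "space (deposition_space N) = UNIV"
  by (simp add: deposition_space_def space_stream_space)

lemma sets_step_law [measurable_cong]: "sets (step_law N) = sets (count_space UNIV)"
  by (simp add: step_law_def)

lemma measurable_snth_explorer [measurable]:
  "(\<lambda>w. w !! n) \<in> measurable (explorer_law N) (count_space UNIV)"
  unfolding explorer_law_def
  using measurable_snth[of n "step_law N"] by (simp cong: measurable_cong_sets add: sets_step_law)

lemma measurable_stake_explorer [measurable]:
  "(\<lambda>w. stake n w) \<in> measurable (explorer_law N) (count_space UNIV)"
proof -
  have "sets (explorer_law N) = sets (stream_space (count_space UNIV))"
    unfolding explorer_law_def by (rule sets_stream_space_cong) (rule sets_step_law)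
  then show ?thesis
    using measurable_stake[of n] by (simp cong: measurable_cong_sets)
qed

text \<open>The event depends only on the first \<open>n + 1\<close> entries, and every predicate on
  the discrete space of lists is measurable.\<close>

lemma measurable_stop [measurable]:
  "Measurable.pred (explorer_law N) (\<lambda>w. z + (\<Sum>k<n. snd (w !! k)) \<le> int (\<sigma> (fst (w !! n))))"
proof -
  have "(\<lambda>w. z + (\<Sum>k<n. snd (w !! k)) \<le> int (\<sigma> (fst (w !! n)))) =
      (\<lambda>w. (\<lambda>xs. z + (\<Sum>k<n. snd (xs ! k)) \<le> int (\<sigma> (fst (xs ! n)))) (stake (Suc n) w))"
    by (intro ext) (simp add: stake_nth del: stake.simps)
  also have "Measurable.pred (explorer_law N) \<dots>"
    by (rule measurable_compose[OF measurable_stake_explorer]) simp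
  finally show ?thesis .
qed

lemma measurable_fst_snth [measurable]:
  "(\<lambda>w. fst (w !! n)) \<in> measurable (explorer_law N) (count_space UNIV)"
  by (rule measurable_compose[OF measurable_snth_explorer]) simp

lemma measurable_caught [measurable]: "Measurable.pred (explorer_law N) (caught \<sigma> C z)"
  unfolding caught_def[abs_def]
  by (intro pred_intros_logic pred_intros_countable pred_intros_countable_bounded measurable_stop
      measurable_compose[OF measurable_fst_snth]) simp_all

lemma measurable_hit_col [measurable]: "hit_col N \<sigma> \<in> measurable (explorer_law N) (count_space UNIV)"
proof -
  have "hit_time N \<sigma> \<in> measurable (explorer_law N) (count_space UNIV)"
    unfolding hit_time_def[abs_def] expl_Z_def expl_X_def by measurable
  then show ?thesis
    unfolding hit_col_def[abs_def] expl_X_def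
    by (rule measurable_compose_countable[where f="\<lambda>n w. fst (w !! n)", OF measurable_fst_snth])
qed

section \<open>The recursion in the starting height and almost sure stopping\<close>

definition catch_prob :: "nat \<Rightarrow> (nat \<Rightarrow> nat) \<Rightarrow> nat set \<Rightarrow> int \<Rightarrow> real" where
  "catch_prob N \<sigma> C z = measure (explorer_law N) {w. caught \<sigma> C z w}"

lemma catch_prob_le_1: "catch_prob N \<sigma> C z \<le> 1" and catch_prob_nonneg: "0 \<le> catch_prob N \<sigma> C z"
  unfolding catch_prob_def using prob_space.prob_le_1[OF prob_space_explorer_law] by auto

lemma catch_prob_rec:
  assumes N: "1 \<le> N"
  shows "catch_prob N \<sigma> C z = (\<Sum>x=1..N. if z \<le> int (\<sigma> x) then of_bool (x \<in> C)
     else (catch_prob N \<sigma> C (z - 1) + catch_prob N \<sigma> C (z + 1)) / 2) / N"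
proof -
  interpret L: prob_space "explorer_law N" by (rule prob_space_explorer_law)
  let ?p = "pair_pmf (pmf_of_set {1..N}) (pmf_of_set {-1, 1::int})"
  define f where "f s = measure (explorer_law N) {w. caught \<sigma> C z (s ## w)}" for s :: "nat \<times> int"
  have f_nonneg: "0 \<le> f s" for s
    by (simp add: f_def)
  have f: "f (x, d) = (if z \<le> int (\<sigma> x) then of_bool (x \<in> C) else catch_prob N \<sigma> C (z + d))" for x d
    using L.prob_space by (auto simp: f_def caught_Stream catch_prob_def)
  have "ennreal (catch_prob N \<sigma> C z) = (\<integral>\<^sup>+s. f s \<partial>step_law N)"
    using prob_space.prob_stream_space[OF prob_space_step_law[of N], of "caught \<sigma> C z"]
      measurable_caught[where N=N and \<sigma>=\<sigma> and C=C and z=z]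
    by (simp add: explorer_law_def[symmetric] catch_prob_def f_def pred_def)
  also have "\<dots> = (\<integral>s. f s \<partial>step_law N)"
    unfolding step_law_def using N
    by (intro nn_integral_eq_integral integrable_measure_pmf_finite)
      (auto simp: f_def set_step_pmf)
  finally have "catch_prob N \<sigma> C z = (\<integral>s. f s \<partial>step_law N)"
    by (subst (asm) ennreal_inj) (simp_all add: catch_prob_nonneg Bochner_Integration.integral_nonneg f_nonneg)
  also have "\<dots> = (\<Sum>s\<in>{1..N} \<times> {-1, 1}. f s * pmf ?p s)"
    unfolding step_law_def using N set_step_pmf[OF N] by (intro integral_measure_pmf_real) auto
  also have "\<dots> = (\<Sum>x\<in>{1..N}. \<Sum>d\<in>{-1,1}. f (x, d) / (2 * real N))"
    unfolding sum.cartesian_product' by (intro sum.cong refl) (use pmf_step[OF N] in auto)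
  also have "\<dots> = (\<Sum>x=1..N. (if z \<le> int (\<sigma> x) then of_bool (x \<in> C)
     else (catch_prob N \<sigma> C (z - 1) + catch_prob N \<sigma> C (z + 1)) / 2) / N)"
    by (intro sum.cong refl) (auto simp: f add_divide_distrib)
  finally show ?thesis by (simp add: sum_divide_distrib)
qed

definition stop_prob :: "nat \<Rightarrow> (nat \<Rightarrow> nat) \<Rightarrow> nat \<Rightarrow> real" where
  "stop_prob N \<sigma> z = (\<Sum>x=1..N. of_bool (z \<le> \<sigma> x)) / N"

lemma stop_prob_nonneg: "0 \<le> stop_prob N \<sigma> z"
  unfolding stop_prob_def by (intro divide_nonneg_nonneg sum_nonneg) auto

lemma stop_prob_le_1: "stop_prob N \<sigma> z \<le> 1"
proof -
  have "(\<Sum>x=1..N. of_bool (z \<le> \<sigma> x) :: real) \<le> (\<Sum>x=1..N. 1)"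
    by (intro sum_mono) auto
  then show ?thesis unfolding stop_prob_def by (intro divide_le_eq_1[THEN iffD2]) auto
qed

text \<open>First-step analysis, arranged as a source term plus a walk killed with probability
  \<open>stop_prob\<close>. In a comparison the source cancels, which leaves the shape required by
  \<open>bounded_subsolution_nonpos\<close>.\<close>

lemma catch_prob_Suc:
  assumes N: "1 \<le> N"
  shows "catch_prob N \<sigma> C (int (Suc z)) = (\<Sum>x=1..N. of_bool (x \<in> C \<and> Suc z \<le> \<sigma> x)) / N +
    (1 - stop_prob N \<sigma> (Suc z)) * ((catch_prob N \<sigma> C (int z) + catch_prob N \<sigma> C (int (Suc (Suc z)))) / 2)"
proof -
  define a where "a = (catch_prob N \<sigma> C (int z) + catch_prob N \<sigma> C (int (Suc (Suc z)))) / 2"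
  have "catch_prob N \<sigma> C (int (Suc z)) =
      (\<Sum>x=1..N. if Suc z \<le> \<sigma> x then of_bool (x \<in> C) else a) / N"
  proof -
    have "int (Suc z) - 1 = int z" "int (Suc z) + 1 = int (Suc (Suc z))" by simp_all
    then show ?thesis
      by (subst catch_prob_rec[OF N]) (simp only: of_nat_le_iff a_def)
  qed
  also have "(\<Sum>x=1..N. if Suc z \<le> \<sigma> x then of_bool (x \<in> C) else a) =
      (\<Sum>x=1..N. of_bool (x \<in> C \<and> Suc z \<le> \<sigma> x) + (a - of_bool (Suc z \<le> \<sigma> x) * a))"
    by (intro sum.cong) auto
  also have "\<dots> = (\<Sum>x=1..N. of_bool (x \<in> C \<and> Suc z \<le> \<sigma> x)) + (N * a - N * stop_prob N \<sigma> (Suc z) * a)"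
    using N by (simp add: sum.distrib sum_subtractf stop_prob_def flip: sum_distrib_right)
  finally show ?thesis
    using N unfolding a_def[symmetric] by (simp add: field_simps)
qed

lemma catch_prob_0:
  assumes N: "1 \<le> N"
  shows "catch_prob N \<sigma> C 0 = (\<Sum>x=1..N. of_bool (x \<in> C)) / N"
  by (subst catch_prob_rec[OF N]) simp

text \<open>The defect \<open>1 - catch_prob\<close> has no source and vanishes at the ground, so
  the maximum principle makes it zero. With \<open>C = UNIV\<close> this is almost sure stopping,
  obtained without recurrence of the walk.\<close>

lemma catch_prob_eq_1:
  assumes N: "1 \<le> N" and C: "{1..N} \<subseteq> C"
  shows "catch_prob N \<sigma> C (int z) = 1"
proof -
  have "1 - catch_prob N \<sigma> C (int z) \<le> 0"
  proof (rule bounded_subsolution_nonpos[where B = 1 and c = "\<lambda>z. 1 - stop_prob N \<sigma> z"])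
    fix z
    have "(\<Sum>x=1..N. of_bool (x \<in> C \<and> Suc z \<le> \<sigma> x)) / N = stop_prob N \<sigma> (Suc z)"
      unfolding stop_prob_def using C by (intro arg_cong2[where f = "(/)"] sum.cong refl) auto
    then show "1 - catch_prob N \<sigma> C (int (Suc z)) \<le> (1 - stop_prob N \<sigma> (Suc z)) *
        ((1 - catch_prob N \<sigma> C (int z) + (1 - catch_prob N \<sigma> C (int (Suc (Suc z))))) / 2)"
      unfolding catch_prob_Suc[OF N, of \<sigma> C z] by (simp add: field_simps)
  next
    have "(\<Sum>x=1..N. of_bool (x \<in> C) :: real) = (\<Sum>x=1..N. 1)"
      using C by (intro sum.cong refl) auto
    then show "1 - catch_prob N \<sigma> C (int 0) \<le> 0"
      unfolding of_nat_0 catch_prob_0[OF N] using N by simp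
  qed (use catch_prob_nonneg in \<open>auto simp: stop_prob_le_1 stop_prob_nonneg\<close>)
  with catch_prob_le_1[of N \<sigma> C "int z"] show ?thesis by simp
qed

section \<open>Visits of the free walk and two-sided capture bounds\<close>

text \<open>\<open>mass s z = (\<Sum>y=1..s. 2 * min z y)\<close> is the expected number of visits to the heights \<open>1, \<dots>, s\<close> of
  the simple random walk started at \<open>z\<close> and stopped at the ground; the subtraction \<open>s - z\<close> is truncated.\<close>

definition mass :: "nat \<Rightarrow> nat \<Rightarrow> real" where
  "mass s z = real (s * (s + 1)) - real ((s - z) * (s - z + 1))"

text \<open>The \<open>1\<close> counts the certain arrival at the ground, and
  \<open>k * (k + 1)\<close> is \<open>mass k z\<close> for a start \<open>z\<close> at or above
  \<open>k\<close>. Each visit falls into a given column with probability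
  \<open>1 / N\<close>.\<close>

definition rate :: "nat \<Rightarrow> real" where
  "rate k = real (1 + k * (k + 1))"

lemma mass_0 [simp]: "mass s 0 = 0"
  by (simp add: mass_def)

lemma mass_top: "s \<le> z \<Longrightarrow> mass s z = real (s * (s + 1))"
  by (simp add: mass_def)

lemma mass_le: "mass s z \<le> real (s * (s + 1))"
  unfolding mass_def diff_le_eq le_add_same_cancel1 by (rule of_nat_0_le_iff)

lemma mass_nonneg: "0 \<le> mass s z"
proof -
  have "(s - z) * (s - z + 1) \<le> s * (s + 1)"
    by (intro mult_mono) auto
  then show ?thesis unfolding mass_def diff_ge_0_iff_ge of_nat_le_iff .
qed

text \<open>The discrete Poisson equation of the free walk with a unit source at the heights
  \<open>1\<close> to \<open>s\<close>; truncated subtraction makes \<open>mass\<close> constant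
  above \<open>s\<close>.\<close>

lemma mass_Suc: "mass s (Suc z) = of_bool (Suc z \<le> s) + (mass s z + mass s (Suc (Suc z))) / 2"
proof (cases "Suc (Suc z) \<le> s")
  case True
  then obtain d where "s = d + Suc (Suc z)"
    using le_iff_add by (metis add.commute)
  then show ?thesis by (simp add: mass_def algebra_simps)
next
  case False
  then consider "s = Suc z" | "s \<le> z" by linarith
  then show ?thesis by cases (auto simp: mass_def field_simps)
qed

lemma sum_of_bool_single:
  assumes "finite A" "i \<in> A"
  shows "(\<Sum>x\<in>A. of_bool (x \<in> {i} \<and> P x)) = (of_bool (P i) :: real)"
proof -
  have "(\<Sum>x\<in>A. of_bool (x \<in> {i} \<and> P x)) = (\<Sum>x\<in>A. if x = i then of_bool (P i) else (0 :: real))"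
    by (intro sum.cong) auto
  then show ?thesis using assms by simp
qed

text \<open>\<open>V\<close> solves the recursion with the same source but without killing. Since
  \<open>V\<close> is nonnegative, it is a supersolution of the killed recursion, with the same
  value \<open>1 / N\<close> at the ground.\<close>

lemma catch_prob_le_rate:
  assumes N: "1 \<le> N" and i: "i \<in> {1..N}"
  shows "catch_prob N \<sigma> {i} (int z) \<le> rate (\<sigma> i) / N"
proof -
  define V where "V z = (1 + mass (\<sigma> i) z) / N" for z
  have V_nonneg: "0 \<le> V z" for z using mass_nonneg by (simp add: V_def)
  have hit: "(\<Sum>x=1..N. of_bool (x \<in> {i} \<and> Suc z \<le> \<sigma> x)) = (of_bool (Suc z \<le> \<sigma> i) :: real)" for z
    by (rule sum_of_bool_single[OF _ i]) simp
  have "catch_prob N \<sigma> {i} (int z) - V z \<le> 0"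
  proof (rule bounded_subsolution_nonpos[where B = 1 and c = "\<lambda>z. 1 - stop_prob N \<sigma> z"])
    fix z
    have "V (Suc z) = of_bool (Suc z \<le> \<sigma> i) / N + (V z + V (Suc (Suc z))) / 2"
      unfolding V_def using N by (subst mass_Suc) (simp add: field_simps)
    moreover have "(1 - stop_prob N \<sigma> (Suc z)) * ((V z + V (Suc (Suc z))) / 2) \<le> 1 * ((V z + V (Suc (Suc z))) / 2)"
      by (intro mult_right_mono) (use V_nonneg stop_prob_nonneg in auto)
    ultimately show "catch_prob N \<sigma> {i} (int (Suc z)) - V (Suc z) \<le> (1 - stop_prob N \<sigma> (Suc z)) *
        ((catch_prob N \<sigma> {i} (int z) - V z + (catch_prob N \<sigma> {i} (int (Suc (Suc z))) - V (Suc (Suc z)))) / 2)"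
      unfolding catch_prob_Suc[OF N, of \<sigma> "{i}" z] hit by (simp add: algebra_simps add_divide_distrib diff_divide_distrib)
  next
    fix z
    show "catch_prob N \<sigma> {i} (int z) - V z \<le> 1"
      using catch_prob_le_1[of N \<sigma> "{i}" "int z"] V_nonneg[of z] by linarith
  next
    show "catch_prob N \<sigma> {i} (int 0) - V 0 \<le> 0"
      using i by (simp add: catch_prob_0[OF N] V_def of_bool_def)
  qed (auto simp: stop_prob_le_1 stop_prob_nonneg)
  moreover have "V z \<le> rate (\<sigma> i) / N"
    unfolding V_def rate_def using mass_le[of "\<sigma> i" z] by (intro divide_right_mono) auto
  ultimately show ?thesis by simp
qed

text \<open>Divided by \<open>N\<close>, this is the expected number of times that a free walk
  started above all columns meets an occupied cell above the ground.\<close>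

definition cover :: "nat \<Rightarrow> (nat \<Rightarrow> nat) \<Rightarrow> nat" where
  "cover N \<sigma> = (\<Sum>j=1..N. \<sigma> j * (\<sigma> j + 1))"

text \<open>Each occupied cell met by the free walk costs at most the largest later value
  \<open>v\<close>. The hypothesis on \<open>z\<close> puts the start above all columns, where
  \<open>V\<close> and \<open>R\<close> have reached their final values.\<close>

lemma catch_prob_ge_rate:
  assumes N: "1 \<le> N" and i: "i \<in> {1..N}" and z: "\<And>j. j \<in> {1..N} \<Longrightarrow> \<sigma> j \<le> z"
  shows "(1 - cover N \<sigma> / N) * (rate (\<sigma> i) / N) \<le> catch_prob N \<sigma> {i} (int z)"
proof -
  define V where "V z = (1 + mass (\<sigma> i) z) / N" for z
  define R where "R z = (\<Sum>j=1..N. mass (\<sigma> j) z) / N" for z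
  define v where "v = rate (\<sigma> i) / N"
  \<comment> \<open>\<open>V\<close> solves the recursion of the free walk; \<open>v * R\<close> bounds what is lost by being caught higher up.\<close>
  define W where "W z = V z - v * R z" for z
  have v_nonneg: "0 \<le> v" by (simp add: v_def rate_def)
  have V_le: "V z \<le> v" for z
    unfolding V_def v_def rate_def using mass_le[of "\<sigma> i" z] by (intro divide_right_mono) auto
  have R_nonneg: "0 \<le> R z" for z
    unfolding R_def by (intro divide_nonneg_nonneg sum_nonneg mass_nonneg) auto
  have W_le: "W z \<le> v" for z
    using V_le[of z] mult_nonneg_nonneg[OF v_nonneg R_nonneg[of z]] by (simp add: W_def)
  have hit: "(\<Sum>x=1..N. of_bool (x \<in> {i} \<and> Suc z \<le> \<sigma> x)) = (of_bool (Suc z \<le> \<sigma> i) :: real)" for z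
    by (rule sum_of_bool_single[OF _ i]) simp
  have "W z - catch_prob N \<sigma> {i} (int z) \<le> 0"
  proof (rule bounded_subsolution_nonpos[where B = v and c = "\<lambda>z. 1 - stop_prob N \<sigma> z"])
    fix z
    let ?p = "stop_prob N \<sigma> (Suc z)"
    have V: "V (Suc z) = of_bool (Suc z \<le> \<sigma> i) / N + (V z + V (Suc (Suc z))) / 2"
      unfolding V_def using N by (subst mass_Suc) (simp add: field_simps)
    have R: "R (Suc z) = ?p + (R z + R (Suc (Suc z))) / 2"
      unfolding R_def stop_prob_def using N
      by (subst mass_Suc) (simp add: sum.distrib sum_divide_distrib[symmetric] field_simps)
    have "W (Suc z) = of_bool (Suc z \<le> \<sigma> i) / N + (W z + W (Suc (Suc z))) / 2 - ?p * v"
      unfolding W_def V R by (simp add: algebra_simps add_divide_distrib diff_divide_distrib)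
    \<comment> \<open>Killing removes at most \<open>?p * v\<close>, which is exactly the source
      term of \<open>v * R\<close>.\<close>
    moreover have "?p * ((W z + W (Suc (Suc z))) / 2) \<le> ?p * v"
      by (intro mult_left_mono stop_prob_nonneg) (use W_le[of z] W_le[of "Suc (Suc z)"] in auto)
    ultimately show "W (Suc z) - catch_prob N \<sigma> {i} (int (Suc z)) \<le> (1 - ?p) *
        ((W z - catch_prob N \<sigma> {i} (int z) + (W (Suc (Suc z)) - catch_prob N \<sigma> {i} (int (Suc (Suc z))))) / 2)"
      unfolding catch_prob_Suc[OF N, of \<sigma> "{i}" z] hit by (simp add: algebra_simps add_divide_distrib diff_divide_distrib)
  next
    fix z
    show "W z - catch_prob N \<sigma> {i} (int z) \<le> v"
      using catch_prob_nonneg[of N \<sigma> "{i}" "int z"] W_le[of z] by linarith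
  next
    show "W 0 - catch_prob N \<sigma> {i} (int 0) \<le> 0"
      using i by (simp add: catch_prob_0[OF N] V_def W_def R_def of_bool_def)
  qed (auto simp: stop_prob_le_1 stop_prob_nonneg)
  moreover have "V z = v"
    using z[OF i] by (simp add: V_def v_def rate_def mass_top)
  moreover have "R z = cover N \<sigma> / N"
    using z by (simp add: R_def cover_def mass_top)
  ultimately show ?thesis
    by (simp add: W_def v_def algebra_simps)
qed

text \<open>The assumption says that the explorer stops; the first stopping index is then unique and
  equals the \<open>LEAST\<close> in \<open>hit_time\<close>.\<close>

lemma caught_iff_hit_col:
  assumes "caught \<sigma> UNIV (int (height_max N \<sigma>) + 1) w"
  shows "caught \<sigma> C (int (height_max N \<sigma>) + 1) w \<longleftrightarrow> hit_col N \<sigma> w \<in> C"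
proof -
  define Q where "Q n \<longleftrightarrow> expl_Z N \<sigma> w n \<le> int (\<sigma> (expl_X w n))" for n
  obtain n where n: "Q n" "\<forall>m<n. \<not> Q m"
    using assms unfolding caught_def Q_def expl_Z_def expl_X_def by blast
  then have "hit_time N \<sigma> w = n"
    unfolding hit_time_def Q_def[symmetric] by (metis Least_equality not_le)
  then have "hit_col N \<sigma> w = expl_X w n"
    by (simp add: hit_col_def)
  moreover have "caught \<sigma> C (int (height_max N \<sigma>) + 1) w \<longleftrightarrow> (\<exists>n. Q n \<and> expl_X w n \<in> C \<and> (\<forall>m<n. \<not> Q m))"
    unfolding caught_def Q_def expl_Z_def expl_X_def ..
  moreover have "Q m \<and> (\<forall>k<m. \<not> Q k) \<Longrightarrow> m = n" for m
    using n by (meson linorder_neqE_nat)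
  ultimately show ?thesis using n by metis
qed

lemma measure_hit_col:
  assumes N: "1 \<le> N"
  shows "measure (explorer_law N) {w. hit_col N \<sigma> w \<in> C} = catch_prob N \<sigma> C (int (Suc (height_max N \<sigma>)))"
proof -
  interpret L: prob_space "explorer_law N" by (rule prob_space_explorer_law)
  let ?z = "int (height_max N \<sigma>) + 1"
  have "AE w in explorer_law N. caught \<sigma> UNIV ?z w"
    using catch_prob_eq_1[OF N subset_UNIV, of \<sigma> "Suc (height_max N \<sigma>)"] measurable_caught[of \<sigma> UNIV ?z N]
    by (subst L.prob_Collect_eq_1[symmetric]) (auto simp: catch_prob_def add.commute pred_def)
  then have "AE w in explorer_law N. hit_col N \<sigma> w \<in> C \<longleftrightarrow> caught \<sigma> C ?z w"
    by eventually_elim (simp add: caught_iff_hit_col)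
  moreover have "Measurable.pred (explorer_law N) (\<lambda>w. hit_col N \<sigma> w \<in> C)"
    by (rule measurable_compose[OF measurable_hit_col]) simp
  ultimately have "measure (explorer_law N) {w \<in> space (explorer_law N). hit_col N \<sigma> w \<in> C} =
      measure (explorer_law N) {w \<in> space (explorer_law N). caught \<sigma> C ?z w}"
    by (intro L.finite_measure_eq_AE) (use measurable_caught[of \<sigma> C ?z N] in \<open>auto simp: pred_def\<close>)
  then show ?thesis by (simp add: catch_prob_def add.commute)
qed

lemma prob_hit_col_in_columns:
  assumes N: "1 \<le> N"
  shows "measure (explorer_law N) {w. hit_col N \<sigma> w \<in> {1..N}} = 1"
  unfolding measure_hit_col[OF N] by (rule catch_prob_eq_1[OF N order_refl])

section \<open>Comparison with independent birth chains\<close>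

lemma prob_hit_col_le:
  assumes "1 \<le> N" "i \<in> {1..N}"
  shows "measure (explorer_law N) {w. hit_col N \<sigma> w = i} \<le> rate (\<sigma> i) / N"
  using measure_hit_col[OF assms(1), of \<sigma> "{i}"] catch_prob_le_rate[OF assms, of \<sigma> "Suc (height_max N \<sigma>)"] by simp

lemma le_height_max: "j \<in> {1..N} \<Longrightarrow> \<sigma> j \<le> height_max N \<sigma>"
  unfolding height_max_def by (intro Max_ge) auto

lemma prob_hit_col_ge:
  assumes "1 \<le> N" "i \<in> {1..N}"
  shows "(1 - cover N \<sigma> / N) * (rate (\<sigma> i) / N) \<le> measure (explorer_law N) {w. hit_col N \<sigma> w = i}"
  using measure_hit_col[OF assms(1), of \<sigma> "{i}"]
    catch_prob_ge_rate[OF assms, of \<sigma> "Suc (height_max N \<sigma>)"] le_height_max[of _ N \<sigma>]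
  by (simp add: le_SucI)

text \<open>The product is affine in each factor. When all increments have the same sign, the mixed
  terms only help, so it dominates its first-order expansion.\<close>

lemma prod_add_ge:
  fixes x d :: "'a \<Rightarrow> real"
  assumes "finite A" and x: "\<And>j. j \<in> A \<Longrightarrow> 0 \<le> x j" "\<And>j. j \<in> A \<Longrightarrow> 0 \<le> x j + d j"
    and d: "(\<forall>j\<in>A. 0 \<le> d j) \<or> (\<forall>j\<in>A. d j \<le> 0)"
  shows "prod x A + (\<Sum>c\<in>A. d c * prod x (A - {c})) \<le> (\<Prod>j\<in>A. x j + d j)"
  using assms
proof (induction A)
  case (insert a A)
  let ?P = "\<Prod>j\<in>A. x j + d j"
  have eq: "prod x (insert a A - {c}) = x a * prod x (A - {c})" if "c \<in> A" for c
  proof -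
    have "insert a A - {c} = insert a (A - {c})" using insert that by auto
    then show ?thesis using insert by simp
  qed
  have "(\<Sum>c\<in>A. d c * prod x (insert a A - {c})) = x a * (\<Sum>c\<in>A. d c * prod x (A - {c}))"
    by (simp add: eq sum_distrib_left mult_ac)
  then have "prod x (insert a A) + (\<Sum>c\<in>insert a A. d c * prod x (insert a A - {c})) =
      x a * (prod x A + (\<Sum>c\<in>A. d c * prod x (A - {c}))) + d a * prod x A"
    using insert by (simp add: algebra_simps)
  also have "\<dots> \<le> x a * ?P + d a * ?P"
  proof (rule add_mono)
    show "x a * (prod x A + (\<Sum>c\<in>A. d c * prod x (A - {c}))) \<le> x a * ?P"
      using insert by (intro mult_left_mono insert.IH) auto
    show "d a * prod x A \<le> d a * ?P"
    proof (cases "0 \<le> d a \<and> (\<forall>j\<in>A. 0 \<le> d j)")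
      case True
      then show ?thesis using insert by (intro mult_left_mono prod_mono) auto
    next
      case False
      then have "d a \<le> 0" "\<forall>j\<in>A. d j \<le> 0" using insert.prems by auto
      then show ?thesis using insert by (intro mult_left_mono_neg prod_mono) auto
    qed
  qed
  finally show ?case using insert by (simp add: algebra_simps)
qed simp

text \<open>On the left exactly one factor is updated, factor \<open>c\<close> with probability
  \<open>p c\<close>; on the right all factors are updated independently with probabilities
  \<open>\<rho> j\<close>. In both cases of \<open>mono\<close>, replacing \<open>p\<close> by
  \<open>\<rho>\<close> raises the first-order expansion, and \<open>prod_add_ge\<close> does the
  rest.\<close>

lemma mean_prod_update_le:
  fixes x y p \<rho> :: "'a \<Rightarrow> real"
  assumes A: "finite A" and p: "sum p A = 1"
    and nn: "\<And>j. j \<in> A \<Longrightarrow> 0 \<le> x j" "\<And>j. j \<in> A \<Longrightarrow> 0 \<le> y j"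
      "\<And>j. j \<in> A \<Longrightarrow> 0 \<le> \<rho> j" "\<And>j. j \<in> A \<Longrightarrow> \<rho> j \<le> 1"
    and mono: "(\<forall>j\<in>A. x j \<le> y j \<and> p j \<le> \<rho> j) \<or> (\<forall>j\<in>A. y j \<le> x j \<and> \<rho> j \<le> p j)"
  shows "(\<Sum>c\<in>A. p c * (\<Prod>j\<in>A. if j = c then y j else x j)) \<le> (\<Prod>j\<in>A. x j + \<rho> j * (y j - x j))"
proof -
  have upd: "(\<Prod>j\<in>A. if j = c then y j else x j) = prod x A + (y c - x c) * prod x (A - {c})" if "c \<in> A" for c
  proof -
    have "(\<Prod>j\<in>A. if j = c then y j else x j) = y c * prod x (A - {c})"
      using A that by (subst prod.remove[of _ c]) (auto intro!: prod.cong)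
    moreover have "prod x A = x c * prod x (A - {c})"
      using A that by (rule prod.remove)
    ultimately show ?thesis by (simp add: algebra_simps)
  qed
  have "(\<Sum>c\<in>A. p c * (\<Prod>j\<in>A. if j = c then y j else x j)) =
      sum p A * prod x A + (\<Sum>c\<in>A. p c * (y c - x c) * prod x (A - {c}))"
    by (simp add: upd sum_distrib_right distrib_left sum.distrib mult.assoc)
  also have "\<dots> \<le> prod x A + (\<Sum>c\<in>A. \<rho> c * (y c - x c) * prod x (A - {c}))"
  proof -
    have "p c * (y c - x c) \<le> \<rho> c * (y c - x c)" if "c \<in> A" for c
      using mono that by (auto intro: mult_right_mono mult_right_mono_neg)
    moreover have "0 \<le> prod x (A - {c})" for c
      using nn by (intro prod_nonneg) auto
    ultimately have "p c * (y c - x c) * prod x (A - {c}) \<le> \<rho> c * (y c - x c) * prod x (A - {c})" if "c \<in> A" for c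
      using that by (rule_tac mult_right_mono)
    then show ?thesis
      unfolding p mult_1_left by (intro add_left_mono sum_mono)
  qed
  also have "\<dots> \<le> (\<Prod>j\<in>A. x j + \<rho> j * (y j - x j))"
  proof (rule prod_add_ge)
    show "0 \<le> x j + \<rho> j * (y j - x j)" if "j \<in> A" for j
    proof -
      have "0 \<le> (1 - \<rho> j) * x j + \<rho> j * y j"
        using nn[OF that] by (intro add_nonneg_nonneg mult_nonneg_nonneg) auto
      then show ?thesis by (simp add: algebra_simps)
    qed
    show "(\<forall>j\<in>A. 0 \<le> \<rho> j * (y j - x j)) \<or> (\<forall>j\<in>A. \<rho> j * (y j - x j) \<le> 0)"
      using mono nn by (auto simp: mult_nonneg_nonpos)
  qed (use A nn in auto)
  finally show ?thesis .
qed

text \<open>The probability that a chain started at \<open>k\<close>, which moves up by one with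
  probability \<open>\<rho>\<close> of its state at each step, is at \<open>K\<close> or above after
  \<open>s\<close> steps. The difference form matches the right side of
  \<open>mean_prod_update_le\<close>.\<close>

primrec birth_prob :: "(nat \<Rightarrow> real) \<Rightarrow> nat \<Rightarrow> nat \<Rightarrow> nat \<Rightarrow> real" where
  "birth_prob \<rho> K 0 k = of_bool (K \<le> k)"
| "birth_prob \<rho> K (Suc s) k = birth_prob \<rho> K s k + \<rho> k * (birth_prob \<rho> K s (Suc k) - birth_prob \<rho> K s k)"

lemma birth_prob_conv: "birth_prob \<rho> K (Suc s) k = (1 - \<rho> k) * birth_prob \<rho> K s k + \<rho> k * birth_prob \<rho> K s (Suc k)"
  by (simp add: algebra_simps)

lemma birth_prob_nonneg_le_1:
  assumes "\<And>k. 0 \<le> \<rho> k" "\<And>k. \<rho> k \<le> 1"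
  shows "0 \<le> birth_prob \<rho> K s k \<and> birth_prob \<rho> K s k \<le> 1"
proof (induction s arbitrary: k)
  case (Suc s)
  have "(1 - \<rho> k) * birth_prob \<rho> K s k + \<rho> k * birth_prob \<rho> K s (Suc k) \<le> (1 - \<rho> k) * 1 + \<rho> k * 1"
    using Suc assms by (intro add_mono mult_left_mono) auto
  moreover have "0 \<le> (1 - \<rho> k) * birth_prob \<rho> K s k + \<rho> k * birth_prob \<rho> K s (Suc k)"
    using Suc assms by (intro add_nonneg_nonneg mult_nonneg_nonneg) auto
  ultimately show ?case unfolding birth_prob_conv by simp
qed simp

text \<open>A step climbs at most one level, so both sides of the induction step can be compared
  with \<open>birth_prob \<rho> K s (Suc k)\<close>.\<close>

lemma birth_prob_mono_Suc:
  assumes \<rho>: "\<And>k. 0 \<le> \<rho> k" "\<And>k. \<rho> k \<le> 1"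
  shows "birth_prob \<rho> K s k \<le> birth_prob \<rho> K s (Suc k)"
proof (induction s arbitrary: k)
  case (Suc s)
  have "birth_prob \<rho> K (Suc s) k \<le> (1 - \<rho> k) * birth_prob \<rho> K s (Suc k) + \<rho> k * birth_prob \<rho> K s (Suc k)"
    unfolding birth_prob_conv using Suc \<rho> by (intro add_mono mult_left_mono) auto
  also have "\<dots> \<le> birth_prob \<rho> K s (Suc k) + \<rho> (Suc k) * (birth_prob \<rho> K s (Suc (Suc k)) - birth_prob \<rho> K s (Suc k))"
    using Suc[of "Suc k"] \<rho> by (simp add: algebra_simps mult_left_mono)
  finally show ?case by simp
qed simp

text \<open>Unlike \<open>config\<close>, this consumes the first explorer first and allows any
  initial configuration, as induction with conditioning on the head of the stream requires.\<close>

primrec config_from :: "nat \<Rightarrow> (nat \<Rightarrow> nat) \<Rightarrow> nat \<Rightarrow> (nat \<times> int) stream stream \<Rightarrow> (nat \<Rightarrow> nat)" where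
  "config_from N \<sigma> 0 \<omega> = \<sigma>"
| "config_from N \<sigma> (Suc t) \<omega> = config_from N (deposit N \<sigma> (shd \<omega>)) t (stl \<omega>)"

lemma config_from_snoc: "deposit N (config_from N \<sigma> t \<omega>) (\<omega> !! t) = config_from N \<sigma> (Suc t) \<omega>"
  by (induction t arbitrary: \<sigma> \<omega>) simp_all

lemma config_eq_config_from: "config N t \<omega> = config_from N (\<lambda>_. 0) t \<omega>"
  by (induction t) (simp_all only: config.simps config_from.simps(1) config_from_snoc[symmetric])

text \<open>The discrete sigma-algebra on the uncountable type of configurations causes no trouble,
  because each step branches over countably many columns.\<close>

lemma measurable_config_from [measurable]:
  "config_from N \<sigma> t \<in> measurable (deposition_space N) (count_space UNIV)"
proof (induction t arbitrary: \<sigma>)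
  case (Suc t)
  have hd: "(\<lambda>\<omega>. hit_col N \<sigma> (shd \<omega>)) \<in> measurable (deposition_space N) (count_space UNIV)"
    unfolding deposition_space_def by measurable
  have stl: "stl \<in> measurable (deposition_space N) (deposition_space N)"
    unfolding deposition_space_def by (rule measurable_stl)
  have "(\<lambda>\<omega>. (\<lambda>c \<omega>. config_from N (\<sigma>(c := Suc (\<sigma> c))) t (stl \<omega>)) (hit_col N \<sigma> (shd \<omega>)) \<omega>)
      \<in> measurable (deposition_space N) (count_space UNIV)"
    by (rule measurable_compose_countable[OF _ hd]) (rule measurable_compose[OF stl Suc.IH])
  then show ?case by (simp add: deposit_def)
next
  case 0
  have "config_from N \<sigma> 0 = (\<lambda>_. \<sigma>)" by auto
  then show ?case by simp
qed

lemma sum_prob_hit_col: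
  assumes "1 \<le> N"
  shows "(\<Sum>c=1..N. measure (explorer_law N) {w. hit_col N \<sigma> w = c}) = 1"
proof -
  interpret L: prob_space "explorer_law N" by (rule prob_space_explorer_law)
  have sets: "{w. hit_col N \<sigma> w = c} \<in> sets (explorer_law N)" for c
    using measurable_sets[OF measurable_hit_col, of "{c}" N \<sigma>] by (simp add: vimage_def)
  have "(\<Sum>c=1..N. measure (explorer_law N) {w. hit_col N \<sigma> w = c}) =
      measure (explorer_law N) (\<Union>c\<in>{1..N}. {w. hit_col N \<sigma> w = c})"
    using sets by (intro L.finite_measure_finite_Union[symmetric]) (auto simp: disjoint_family_on_def)
  also have "(\<Union>c\<in>{1..N}. {w. hit_col N \<sigma> w = c}) = {w. hit_col N \<sigma> w \<in> {1..N}}"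
    by auto
  finally show ?thesis using prob_hit_col_in_columns[OF assms] by simp
qed

lemma nn_integral_hit_col:
  assumes "1 \<le> N"
  shows "(\<integral>\<^sup>+w. g (hit_col N \<sigma> w) \<partial>explorer_law N) =
    (\<Sum>c=1..N. ennreal (measure (explorer_law N) {w. hit_col N \<sigma> w = c}) * g c)"
proof -
  interpret L: prob_space "explorer_law N" by (rule prob_space_explorer_law)
  have sets: "{w. hit_col N \<sigma> w = c} \<in> sets (explorer_law N)" for c
    using measurable_sets[OF measurable_hit_col, of "{c}" N \<sigma>] by (simp add: vimage_def)
  have "AE w in explorer_law N. hit_col N \<sigma> w \<in> {1..N}"
    using prob_hit_col_in_columns[OF assms, of \<sigma>] measurable_sets[OF measurable_hit_col, of "{1..N}" N \<sigma>]
    by (subst L.prob_Collect_eq_1[symmetric]) (auto simp: vimage_def)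
  then have "(\<integral>\<^sup>+w. g (hit_col N \<sigma> w) \<partial>explorer_law N) =
      (\<integral>\<^sup>+w. (\<Sum>c=1..N. g c * indicator {w. hit_col N \<sigma> w = c} w) \<partial>explorer_law N)"
    by (intro nn_integral_cong_AE, eventually_elim) (simp add: indicator_def if_distrib cong: if_cong)
  also have "\<dots> = (\<Sum>c=1..N. g c * emeasure (explorer_law N) {w. hit_col N \<sigma> w = c})"
    using sets by (subst nn_integral_sum) (auto simp: nn_integral_cmult_indicator)
  finally show ?thesis
    by (simp add: L.emeasure_eq_measure mult.commute)
qed

lemma nn_integral_config_Suc:
  assumes "1 \<le> N"
  shows "(\<integral>\<^sup>+\<omega>. F (config_from N \<sigma> (Suc t) \<omega>) \<partial>deposition_space N) =
    (\<Sum>c=1..N. ennreal (measure (explorer_law N) {w. hit_col N \<sigma> w = c}) *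
      (\<integral>\<^sup>+\<omega>. F (config_from N (\<sigma>(c := Suc (\<sigma> c))) t \<omega>) \<partial>deposition_space N))"
proof -
  interpret L: prob_space "explorer_law N" by (rule prob_space_explorer_law)
  have "(\<lambda>\<omega>. F (config_from N \<sigma> (Suc t) \<omega>)) \<in> borel_measurable (deposition_space N)"
    by (rule measurable_compose[OF measurable_config_from]) simp
  then have "(\<integral>\<^sup>+\<omega>. F (config_from N \<sigma> (Suc t) \<omega>) \<partial>deposition_space N) =
      (\<integral>\<^sup>+w. \<integral>\<^sup>+\<omega>. F (config_from N \<sigma> (Suc t) (w ## \<omega>)) \<partial>deposition_space N \<partial>explorer_law N)"
    unfolding deposition_space_def by (rule L.nn_integral_stream_space)
  also have "\<dots> = (\<integral>\<^sup>+w. (\<lambda>c. \<integral>\<^sup>+\<omega>. F (config_from N (\<sigma>(c := Suc (\<sigma> c))) t \<omega>) \<partial>deposition_space N) (hit_col N \<sigma> w)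
      \<partial>explorer_law N)"
    by (simp add: deposit_def)
  also note nn_integral_hit_col[OF assms]
  finally show ?thesis .
qed

text \<open>Although the columns interact, this product behaves as if they were independent, because each
  explorer changes a single factor. For the lower comparison \<open>\<theta> = -1\<close>, and \<open>G\<close> is the event that the
  cover is still small.\<close>

lemma nn_integral_prod_birth_le:
  fixes \<theta> :: real and \<rho> :: "nat \<Rightarrow> real"
  assumes N: "1 \<le> N" and \<rho>: "\<And>k. 0 \<le> \<rho> k" "\<And>k. \<rho> k \<le> 1" and \<theta>: "-1 \<le> \<theta>"
    and G: "\<And>\<sigma> c. G (\<sigma>(c := Suc (\<sigma> c))) \<Longrightarrow> G \<sigma>"
    and cmp: "0 \<le> \<theta> \<and> (\<forall>\<sigma> j. G \<sigma> \<longrightarrow> j \<in> {1..N} \<longrightarrow> measure (explorer_law N) {w. hit_col N \<sigma> w = j} \<le> \<rho> (\<sigma> j)) \<or>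
      \<theta> \<le> 0 \<and> (\<forall>\<sigma> j. G \<sigma> \<longrightarrow> j \<in> {1..N} \<longrightarrow> \<rho> (\<sigma> j) \<le> measure (explorer_law N) {w. hit_col N \<sigma> w = j})"
  shows "(\<integral>\<^sup>+\<omega>. of_bool (G (config_from N \<sigma> t \<omega>)) *
      ennreal (\<Prod>j=1..N. 1 + \<theta> * of_bool (K \<le> config_from N \<sigma> t \<omega> j)) \<partial>deposition_space N)
    \<le> ennreal (\<Prod>j=1..N. 1 + \<theta> * birth_prob \<rho> K t (\<sigma> j))"
proof (induction t arbitrary: \<sigma>)
  case 0
  interpret D: prob_space "deposition_space N" by (rule prob_space_deposition_space)
  show ?case using D.emeasure_space_1 by simp
next
  case (Suc t)
  define f where "f k = 1 + \<theta> * birth_prob \<rho> K t k" for k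
  let ?p = "\<lambda>c. measure (explorer_law N) {w. hit_col N \<sigma> w = c}"
  let ?F = "\<lambda>\<tau>. of_bool (G \<tau>) * ennreal (\<Prod>j=1..N. 1 + \<theta> * of_bool (K \<le> \<tau> j))"
  have f_nonneg: "0 \<le> f k" for k
  proof -
    have "- 1 \<le> \<theta> * birth_prob \<rho> K t k"
    proof (cases "0 \<le> \<theta>")
      case True
      then have "0 \<le> \<theta> * birth_prob \<rho> K t k" using birth_prob_nonneg_le_1[of \<rho>, OF \<rho>] by simp
      then show ?thesis by linarith
    next
      case False
      then have "\<theta> * 1 \<le> \<theta> * birth_prob \<rho> K t k"
        using birth_prob_nonneg_le_1[of \<rho>, OF \<rho>] by (intro mult_left_mono_neg) auto
      then show ?thesis using \<theta> by linarith
    qed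
    then show ?thesis by (simp add: f_def)
  qed
  show ?case
  proof (cases "G \<sigma>")
    case False
    \<comment> \<open>Once \<open>G\<close> fails it fails forever, so the integrand vanishes and no
      comparison of rates is needed.\<close>
    have "\<not> G (config_from N \<sigma> t \<omega>)" for t \<omega>
    proof (induction t)
      case (Suc t)
      then show ?case
        unfolding config_from_snoc[symmetric] deposit_def using G by blast
    qed (simp add: False)
    from this[of "Suc t"] show ?thesis by (simp del: config_from.simps)
  next
    case True
    have "(\<integral>\<^sup>+\<omega>. ?F (config_from N \<sigma> (Suc t) \<omega>) \<partial>deposition_space N) =
        (\<Sum>c=1..N. ennreal (?p c) * (\<integral>\<^sup>+\<omega>. ?F (config_from N (\<sigma>(c := Suc (\<sigma> c))) t \<omega>) \<partial>deposition_space N))"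
      by (rule nn_integral_config_Suc[OF N])
    also have "\<dots> \<le> (\<Sum>c=1..N. ennreal (?p c) * ennreal (\<Prod>j=1..N. f ((\<sigma>(c := Suc (\<sigma> c))) j)))"
      unfolding f_def by (intro sum_mono mult_left_mono Suc.IH) auto
    also have "\<dots> = ennreal (\<Sum>c=1..N. ?p c * (\<Prod>j=1..N. if j = c then f (Suc (\<sigma> j)) else f (\<sigma> j)))"
      by (subst sum_ennreal[symmetric])
        (auto intro!: sum.cong mult_nonneg_nonneg prod_nonneg f_nonneg arg_cong[where f=ennreal] prod.cong
          simp: ennreal_mult'[symmetric])
    also have "\<dots> \<le> ennreal (\<Prod>j=1..N. f (\<sigma> j) + \<rho> (\<sigma> j) * (f (Suc (\<sigma> j)) - f (\<sigma> j)))"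
    proof (intro ennreal_leI mean_prod_update_le)
      have "f k \<le> f (Suc k)" if "0 \<le> \<theta>" for k
        unfolding f_def using that birth_prob_mono_Suc[of \<rho>, OF \<rho>] by (simp add: mult_left_mono)
      moreover have "f (Suc k) \<le> f k" if "\<theta> \<le> 0" for k
        unfolding f_def using that birth_prob_mono_Suc[of \<rho>, OF \<rho>] by (simp add: mult_left_mono_neg)
      ultimately show "(\<forall>j\<in>{1..N}. f (\<sigma> j) \<le> f (Suc (\<sigma> j)) \<and> ?p j \<le> \<rho> (\<sigma> j)) \<or>
          (\<forall>j\<in>{1..N}. f (Suc (\<sigma> j)) \<le> f (\<sigma> j) \<and> \<rho> (\<sigma> j) \<le> ?p j)"
        using cmp True by blast
    qed (use \<rho> f_nonneg sum_prob_hit_col[OF N] in auto)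
    also have "(\<Prod>j=1..N. f (\<sigma> j) + \<rho> (\<sigma> j) * (f (Suc (\<sigma> j)) - f (\<sigma> j))) =
        (\<Prod>j=1..N. 1 + \<theta> * birth_prob \<rho> K (Suc t) (\<sigma> j))"
      by (intro prod.cong) (auto simp: f_def algebra_simps)
    finally show ?thesis .
  qed
qed

section \<open>Tail bounds for the columns through birth chains\<close>

lemma sets_config [measurable]: "{\<omega>. P (config N t \<omega>)} \<in> sets (deposition_space N)"
  using measurable_sets[OF measurable_config_from, of "Collect P" N "\<lambda>_. 0" t]
  by (simp add: vimage_def config_eq_config_from)

text \<open>Truncation at \<open>1\<close> yields a legitimate jump probability and keeps the bound
  valid, since hitting probabilities are at most \<open>1\<close>.\<close>

definition upper_rate :: "nat \<Rightarrow> nat \<Rightarrow> real" where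
  "upper_rate N k = min 1 (rate k / N)"

text \<open>The factor \<open>2\<close> comes from \<open>1 - cover N \<sigma> / N\<close> being at
  least one half while \<open>2 * cover N \<sigma>\<close> is at most \<open>N\<close>.\<close>

definition lower_rate :: "nat \<Rightarrow> nat \<Rightarrow> real" where
  "lower_rate N k = min 1 (rate k / (2 * N))"

lemma rate_pos: "0 < rate k"
  unfolding rate_def of_nat_0_less_iff by simp

lemma upper_rate_nonneg: "0 \<le> upper_rate N k" and upper_rate_le_1: "upper_rate N k \<le> 1"
  using rate_pos[of k] by (simp_all add: upper_rate_def)

lemma lower_rate_nonneg: "0 \<le> lower_rate N k" and lower_rate_le_1: "lower_rate N k \<le> 1"
  using rate_pos[of k] by (simp_all add: lower_rate_def)

text \<open>A Chernoff bound: the product over the columns is \<open>1 + \<theta>\<close> to the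
  number of tall columns.\<close>

lemma prob_many_tall_le:
  assumes N: "1 \<le> N" and \<theta>: "0 \<le> \<theta>"
  shows "(1 + \<theta>) ^ m * measure (deposition_space N) {\<omega>. m \<le> card {j\<in>{1..N}. K \<le> config N t \<omega> j}}
    \<le> (1 + \<theta> * birth_prob (upper_rate N) K t 0) ^ N"
proof -
  interpret D: prob_space "deposition_space N" by (rule prob_space_deposition_space)
  interpret L: prob_space "explorer_law N" by (rule prob_space_explorer_law)
  let ?c = "config_from N (\<lambda>_. 0) t"
  let ?S = "{\<omega>. m \<le> card {j\<in>{1..N}. K \<le> config N t \<omega> j}}"
  let ?u = "birth_prob (upper_rate N) K t 0"
  have u: "0 \<le> ?u"
    using birth_prob_nonneg_le_1[of "upper_rate N", OF upper_rate_nonneg upper_rate_le_1] by blast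
  have prod: "(\<Prod>j=1..N. 1 + \<theta> * of_bool (K \<le> ?c \<omega> j)) = (1 + \<theta>) ^ card {j\<in>{1..N}. K \<le> config N t \<omega> j}" for \<omega>
  proof -
    have "(\<Prod>j=1..N. 1 + \<theta> * of_bool (K \<le> ?c \<omega> j)) = (\<Prod>j=1..N. if K \<le> ?c \<omega> j then 1 + \<theta> else 1)"
      by (intro prod.cong) auto
    then show ?thesis
      by (simp add: prod.If_cases config_eq_config_from Int_def)
  qed
  have "ennreal ((1 + \<theta>) ^ m * measure (deposition_space N) ?S) = (\<integral>\<^sup>+\<omega>. ennreal ((1 + \<theta>) ^ m) * indicator ?S \<omega> \<partial>deposition_space N)"
    using \<theta> sets_config[of "\<lambda>\<tau>. m \<le> card {j\<in>{1..N}. K \<le> \<tau> j}" N t]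
    by (subst nn_integral_cmult_indicator) (auto simp: ennreal_mult' D.emeasure_eq_measure)
  also have "\<dots> \<le> (\<integral>\<^sup>+\<omega>. of_bool True * ennreal (\<Prod>j=1..N. 1 + \<theta> * of_bool (K \<le> ?c \<omega> j)) \<partial>deposition_space N)"
    unfolding prod using \<theta> by (intro nn_integral_mono) (auto split: split_indicator intro!: ennreal_leI power_increasing)
  also have "\<dots> \<le> ennreal (\<Prod>j=1..N. 1 + \<theta> * ?u)"
    using \<theta> prob_hit_col_le[OF N]
    by (intro nn_integral_prod_birth_le[where G = "\<lambda>_. True", OF N])
      (simp_all add: upper_rate_nonneg upper_rate_le_1, simp add: upper_rate_def)
  finally show ?thesis
    using \<theta> u by (subst (asm) ennreal_le_iff) auto
qed

lemma cover_mono_update: "cover N \<sigma> \<le> cover N (\<sigma>(c := Suc (\<sigma> c)))"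
  unfolding cover_def by (intro sum_mono) auto

text \<open>For \<open>\<theta> = -1\<close> the product is the indicator that no column has reached
  \<open>H\<close>, and \<open>G\<close> keeps the lower rates valid.\<close>

lemma prob_all_short_le:
  assumes N: "1 \<le> N"
  shows "measure (deposition_space N) {\<omega>. 2 * cover N (config N t \<omega>) \<le> N \<and> (\<forall>j\<in>{1..N}. config N t \<omega> j < H)}
    \<le> (1 - birth_prob (lower_rate N) H t 0) ^ N"
proof -
  interpret D: prob_space "deposition_space N" by (rule prob_space_deposition_space)
  let ?c = "config_from N (\<lambda>_. 0) t"
  let ?S = "{\<omega>. 2 * cover N (config N t \<omega>) \<le> N \<and> (\<forall>j\<in>{1..N}. config N t \<omega> j < H)}"
  let ?u = "birth_prob (lower_rate N) H t 0"
  have u: "?u \<le> 1"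
    using birth_prob_nonneg_le_1[of "lower_rate N", OF lower_rate_nonneg lower_rate_le_1] by blast
  have "ennreal (measure (deposition_space N) ?S) = (\<integral>\<^sup>+\<omega>. indicator ?S \<omega> \<partial>deposition_space N)"
    using sets_config[of "\<lambda>\<tau>. 2 * cover N \<tau> \<le> N \<and> (\<forall>j\<in>{1..N}. \<tau> j < H)" N t]
    by (subst nn_integral_indicator) (auto simp: D.emeasure_eq_measure)
  also have "\<dots> \<le> (\<integral>\<^sup>+\<omega>. of_bool (2 * cover N (?c \<omega>) \<le> N) * ennreal (\<Prod>j=1..N. 1 + (-1) * of_bool (H \<le> ?c \<omega> j)) \<partial>deposition_space N)"
  proof (intro nn_integral_mono)
    fix \<omega>
    have "(\<Prod>j=1..N. 1 + (-1) * of_bool (H \<le> ?c \<omega> j)) = (1 :: real)" if "\<omega> \<in> ?S"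
      using that by (intro prod.neutral) (auto simp: config_eq_config_from not_le)
    then show "indicator ?S \<omega> \<le> of_bool (2 * cover N (?c \<omega>) \<le> N) * ennreal (\<Prod>j=1..N. 1 + (-1) * of_bool (H \<le> ?c \<omega> j))"
      by (auto simp: indicator_def config_eq_config_from)
  qed
  also have "\<dots> \<le> ennreal (\<Prod>j=1..N. 1 + (-1) * ?u)"
  proof (intro nn_integral_prod_birth_le[where G = "\<lambda>\<tau>. 2 * cover N \<tau> \<le> N", OF N] disjI2 conjI allI impI)
    fix \<sigma> j assume *: "2 * cover N \<sigma> \<le> N" "j \<in> {1..N}"
    then have "1 / 2 * (rate (\<sigma> j) / N) \<le> (1 - cover N \<sigma> / N) * (rate (\<sigma> j) / N)"
      using rate_pos[of "\<sigma> j"] N by (intro mult_right_mono) (auto simp: field_simps)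
    with prob_hit_col_ge[OF N *(2), of \<sigma>]
    show "lower_rate N (\<sigma> j) \<le> measure (explorer_law N) {w. hit_col N \<sigma> w = j}"
      by (simp add: lower_rate_def min_le_iff_disj)
  next
    fix \<sigma> c assume "2 * cover N (\<sigma>(c := Suc (\<sigma> c))) \<le> N"
    then show "2 * cover N \<sigma> \<le> N"
      using cover_mono_update[of N \<sigma> c] by linarith
  qed (auto simp: lower_rate_nonneg lower_rate_le_1)
  finally show ?thesis
    using u by (subst (asm) ennreal_le_iff) auto
qed

section \<open>Estimates for birth chains\<close>

context
  fixes \<rho> :: "nat \<Rightarrow> real"
  assumes \<rho>: "\<And>k. 0 \<le> \<rho> k" "\<And>k. \<rho> k \<le> 1"
begin

lemma birth_prob_ge_target: "H \<le> k \<Longrightarrow> birth_prob \<rho> H s k = 1"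
  by (induction s arbitrary: k) auto

lemma birth_prob_mono_time: "s \<le> t \<Longrightarrow> birth_prob \<rho> H s k \<le> birth_prob \<rho> H t k"
proof (induction rule: dec_induct)
  case (step t)
  have "0 \<le> \<rho> k * (birth_prob \<rho> H t (Suc k) - birth_prob \<rho> H t k)"
    using \<rho> birth_prob_mono_Suc[of \<rho>, OF \<rho>] by (intro mult_nonneg_nonneg) auto
  with step show ?case by simp
qed simp

text \<open>The chain leaves \<open>k\<close> within \<open>s\<close> steps with probability
  \<open>1 - (1 - \<rho> k) ^ s\<close>; at least \<open>s'\<close> steps then remain from the next
  level.\<close>

lemma birth_prob_step:
  "(1 - (1 - \<rho> k) ^ s) * birth_prob \<rho> H s' (Suc k) \<le> birth_prob \<rho> H (s + s') k"
proof (induction s)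
  case 0
  then show ?case using birth_prob_nonneg_le_1[of \<rho>, OF \<rho>] by simp
next
  case (Suc s)
  let ?b = "birth_prob \<rho> H s' (Suc k)"
  have "(1 - (1 - \<rho> k) ^ Suc s) * ?b = (1 - \<rho> k) * ((1 - (1 - \<rho> k) ^ s) * ?b) + \<rho> k * ?b"
    by (simp add: algebra_simps)
  also have "\<dots> \<le> (1 - \<rho> k) * birth_prob \<rho> H (s + s') k + \<rho> k * birth_prob \<rho> H (s + s') (Suc k)"
    using Suc \<rho> birth_prob_mono_time[of s' "s + s'" H "Suc k"]
    by (intro add_mono mult_left_mono) auto
  also have "\<dots> = birth_prob \<rho> H (Suc s + s') k"
    by (simp add: algebra_simps)
  finally show ?case .
qed

lemma birth_prob_block:
  "(\<Prod>k<K. 1 - (1 - \<rho> k) ^ s) * birth_prob \<rho> H s' K \<le> birth_prob \<rho> H (K * s + s') 0"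
proof (induction K arbitrary: s')
  case (Suc K)
  have "(\<Prod>k<Suc K. 1 - (1 - \<rho> k) ^ s) * birth_prob \<rho> H s' (Suc K) =
      (\<Prod>k<K. 1 - (1 - \<rho> k) ^ s) * ((1 - (1 - \<rho> K) ^ s) * birth_prob \<rho> H s' (Suc K))"
    by simp
  also have "\<dots> \<le> (\<Prod>k<K. 1 - (1 - \<rho> k) ^ s) * birth_prob \<rho> H (s + s') K"
    using \<rho> by (intro mult_left_mono birth_prob_step prod_nonneg) (auto simp: power_le_one)
  also have "\<dots> \<le> birth_prob \<rho> H (Suc K * s + s') 0"
    using Suc[of "s + s'"] by (simp add: algebra_simps)
  finally show ?case .
qed simp

text \<open>Markov's inequality for the hitting time of \<open>H\<close>, whose mean is the sum of
  the mean waiting times \<open>1 / \<rho> j\<close>.\<close>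

lemma birth_prob_markov:
  assumes pos: "\<And>k. 0 < \<rho> k"
  shows "s * (1 - birth_prob \<rho> H s k) \<le> (\<Sum>j=k..<H. 1 / \<rho> j)"
proof -
  \<comment> \<open>The sum of tail probabilities is the mean of the hitting time truncated at
    \<open>s\<close>.\<close>
  have tail: "(\<Sum>i<s. 1 - birth_prob \<rho> H i k) \<le> (\<Sum>j=k..<H. 1 / \<rho> j)" for s k
  proof (induction s arbitrary: k)
    case 0
    then show ?case using \<rho> by (simp add: sum_nonneg)
  next
    case (Suc s)
    show ?case
    proof (cases "H \<le> k")
      case True
      then show ?thesis by (simp add: birth_prob_ge_target del: birth_prob.simps)
    next
      case False
      let ?m = "\<lambda>k. \<Sum>j=k..<H. 1 / \<rho> j"
      have m: "?m k = 1 / \<rho> k + ?m (Suc k)"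
        using False by (simp add: sum.atLeast_Suc_lessThan)
      have "(\<Sum>i<Suc s. 1 - birth_prob \<rho> H i k) =
          1 + (\<Sum>i<s. (1 - \<rho> k) * (1 - birth_prob \<rho> H i k) + \<rho> k * (1 - birth_prob \<rho> H i (Suc k)))"
        using False unfolding sum.lessThan_Suc_shift
        by (simp add: algebra_simps)
      also have "\<dots> = 1 + ((1 - \<rho> k) * (\<Sum>i<s. 1 - birth_prob \<rho> H i k) + \<rho> k * (\<Sum>i<s. 1 - birth_prob \<rho> H i (Suc k)))"
        by (simp only: sum.distrib sum_distrib_left)
      also have "\<dots> \<le> 1 + ((1 - \<rho> k) * ?m k + \<rho> k * ?m (Suc k))"
        using \<rho> Suc by (intro add_left_mono add_mono mult_left_mono) auto
      also have "\<dots> = ?m k"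
        using pos[of k] unfolding m by (simp add: field_simps)
      finally show ?thesis .
    qed
  qed
  have "s * (1 - birth_prob \<rho> H s k) = (\<Sum>i<s. 1 - birth_prob \<rho> H s k)"
    by simp
  also have "\<dots> \<le> (\<Sum>i<s. 1 - birth_prob \<rho> H i k)"
    by (intro sum_mono) (simp add: birth_prob_mono_time)
  finally show ?thesis using tail[of k s] by linarith
qed

end

section \<open>Chains with quadratic rates\<close>

lemma rate_le_square: "k < K \<Longrightarrow> rate k \<le> real K ^ 2"
proof -
  assume "k < K"
  then have "1 + k * (k + 1) \<le> (k + 1) * (k + 1)" "(k + 1) * (k + 1) \<le> K * K"
    by (simp, intro mult_mono) auto
  then have "1 + k * (k + 1) \<le> K ^ 2" unfolding power2_eq_square by linarith
  then show ?thesis unfolding rate_def by (metis of_nat_le_iff of_nat_power)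
qed

lemma exp_2_le: "exp (2::real) \<le> 9"
  using power_mono[OF exp_le, of 2] by (simp flip: exp_double)

text \<open>Exponential moments with base \<open>x = exp 2\<close>: below \<open>K\<close> a step
  multiplies the moment by at most \<open>c\<close>. As \<open>x - 1\<close> is at most
  \<open>8\<close>, the hypothesis bounds \<open>c ^ t\<close> by \<open>exp K\<close>, against the
  gain \<open>exp (- 2 * K)\<close>.\<close>

lemma birth_prob_upper_rate_le:
  assumes N: "1 \<le> N" and K: "8 * K * t \<le> N"
  shows "birth_prob (upper_rate N) K t 0 \<le> exp (- real K)"
proof -
  define x where "x = exp (2::real)"
  define c where "c = 1 + (x - 1) * (real K ^ 2 / N)"
  have x: "1 \<le> x" "x \<le> 9" using exp_2_le by (simp_all add: x_def)
  then have c: "1 \<le> c" by (simp add: c_def)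
  have "birth_prob (upper_rate N) K s k \<le> c ^ s * (x ^ k / x ^ K)" for s k
  proof (induction s arbitrary: k)
    case 0
    then show ?case using x by (simp add: power_increasing)
  next
    case (Suc s)
    show ?case
    proof (cases "K \<le> k")
      case True
      then have "1 \<le> x ^ k / x ^ K" using x by (simp add: power_increasing)
      then have "1 * 1 \<le> c ^ Suc s * (x ^ k / x ^ K)"
        using c x by (intro mult_mono one_le_power) auto
      moreover have "birth_prob (upper_rate N) K (Suc s) k = 1"
        by (rule birth_prob_ge_target[OF upper_rate_nonneg upper_rate_le_1 True])
      ultimately show ?thesis by linarith
    next
      case False
      let ?q = "upper_rate N k" and ?B = "c ^ s * (x ^ k / x ^ K)"
      have "?q \<le> rate k / N" by (simp add: upper_rate_def)
      also have "\<dots> \<le> real K ^ 2 / N"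
        using rate_le_square[of k K] False by (intro divide_right_mono) auto
      finally have q: "?q \<le> real K ^ 2 / N" .
      have shift: "c ^ s * (x ^ Suc k / x ^ K) = x * ?B" by simp
      have collect: "(1 - q) * B + q * (x * B) = (1 + (x - 1) * q) * B" for q B
        by (simp add: algebra_simps)
      have "birth_prob (upper_rate N) K (Suc s) k \<le> (1 - ?q) * ?B + ?q * (x * ?B)"
        unfolding birth_prob_conv using upper_rate_nonneg upper_rate_le_1
        using Suc.IH[of k] Suc.IH[of "Suc k", unfolded shift] by (intro add_mono mult_left_mono) simp_all
      also have "\<dots> = (1 + (x - 1) * ?q) * ?B"
        by (rule collect)
      also have "\<dots> \<le> c * ?B"
        unfolding c_def using q x c
        by (intro mult_right_mono add_left_mono mult_left_mono mult_nonneg_nonneg) auto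
      finally show ?thesis by (simp add: mult.assoc)
    qed
  qed
  then have "birth_prob (upper_rate N) K t 0 \<le> c ^ t * (1 / x ^ K)"
    by (metis power_0)
  also have "c ^ t \<le> exp ((x - 1) * (real K ^ 2 / N)) ^ t"
    using c unfolding c_def by (intro power_mono exp_ge_add_one_self) auto
  also have "\<dots> = exp (t * ((x - 1) * (real K ^ 2 / N)))"
    by (rule exp_of_nat_mult[symmetric])
  also have "\<dots> \<le> exp (real K)"
  proof -
    have "real t * ((x - 1) * (real K ^ 2 / N)) \<le> real t * (8 * (real K ^ 2 / N))"
      using x by (intro mult_left_mono mult_right_mono) auto
    also have "\<dots> = real K * (real (8 * K * t) / N)"
      by (simp add: power2_eq_square)
    also have "\<dots> \<le> real K * 1"
      using K N by (intro mult_left_mono) (auto simp: divide_le_eq_1 simp del: of_nat_mult)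
    finally show ?thesis by simp
  qed
  finally have "birth_prob (upper_rate N) K t 0 \<le> exp (real K) * (1 / x ^ K)"
    using x by (simp add: divide_right_mono)
  also have "x ^ K = exp (real K) * exp (real K)"
    unfolding x_def exp_add[symmetric] exp_of_nat_mult[symmetric] by (simp add: mult.commute)
  also have "exp (real K) * (1 / (exp (real K) * exp (real K))) = exp (- real K)"
    by (simp add: exp_minus divide_inverse)
  finally show ?thesis .
qed

lemma power_self_le_fact_exp: "real K ^ K \<le> fact K * exp (real K)"
proof (induction K)
  case (Suc K)
  have "real (Suc K) ^ K \<le> real K ^ K * exp 1"
  proof (cases "K = 0")
    case False
    have "(1 + 1 / real K) ^ K \<le> exp (1 / real K) ^ K"
      by (intro power_mono exp_ge_add_one_self) auto
    also have "\<dots> = exp 1"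
      using False by (simp flip: exp_of_nat_mult)
    finally have "real K ^ K * (1 + 1 / real K) ^ K \<le> real K ^ K * exp 1"
      by (intro mult_left_mono) auto
    moreover have "real (Suc K) = real K * (1 + 1 / real K)"
      using False by (simp add: field_simps)
    ultimately show ?thesis
      by (simp only: power_mult_distrib)
  qed simp
  also have "\<dots> \<le> fact K * exp (real K) * exp 1"
    by (intro mult_right_mono Suc) auto
  finally have "real (Suc K) * real (Suc K) ^ K \<le> real (Suc K) * (fact K * exp (real K) * exp 1)"
    by (intro mult_left_mono) auto
  then show ?case by (simp add: exp_add algebra_simps)
qed simp

lemma one_minus_exp_ge:
  fixes y :: real
  assumes "0 \<le> y" "y \<le> 1"
  shows "y / 2 \<le> 1 - exp (- y)"
proof -
  have "exp (- y) \<le> 1 / (1 + y)"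
    using exp_ge_add_one_self[of y] assms by (simp add: exp_minus divide_inverse le_imp_inverse_le)
  also have "\<dots> \<le> 1 - y / 2"
  proof -
    have "y * y \<le> y" using assms by (simp add: mult_left_le)
    then have "1 \<le> (1 - y / 2) * (1 + y)" by (simp add: algebra_simps)
    then show ?thesis using assms by (subst pos_divide_le_eq) auto
  qed
  finally show ?thesis by simp
qed

text \<open>Comparison with the telescoping sum of \<open>1 / (j * (j + 1))\<close>. The bound is
  uniform in \<open>H\<close>, which is the source of the explosion.\<close>

lemma sum_inverse_rate_le:
  assumes "1 \<le> K"
  shows "(\<Sum>j=K..<H. 1 / rate j) \<le> 1 / K"
proof -
  have "(\<Sum>j=K..<H. 1 / rate j) \<le> 1 / K - 1 / H" if "K \<le> H" for H
    using that
  proof (induction rule: dec_induct)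
    case (step H)
    have "0 < H" using assms step by simp
    then have "0 < real (H * (H + 1))" unfolding of_nat_0_less_iff by simp
    then have "1 / rate H \<le> 1 / real (H * (H + 1))"
      using rate_pos[of H] by (intro divide_left_mono mult_pos_pos) (auto simp: rate_def)
    also have "\<dots> = 1 / H - 1 / Suc H"
      using \<open>0 < H\<close> by (simp add: field_simps)
    finally show ?case using step by simp
  qed simp
  from this[of H] show ?thesis
    by (cases "K \<le> H") (simp_all add: order_trans[of _ "1 / real K - 1 / real H"])
qed

text \<open>First \<open>K\<close> levels are climbed with \<open>s\<close> steps allowed for each,
  at cost \<open>exp (- 4 * K)\<close>; then \<open>H\<close> is reached within \<open>s'\<close>
  steps with probability at least one half. The bound on \<open>H\<close> makes the truncation in
  \<open>lower_rate\<close> inactive below \<open>H\<close>.\<close>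

lemma birth_prob_lower_rate_ge:
  assumes K: "1 \<le> K" "K \<le> H" and N: "1 \<le> N" and H: "H ^ 2 \<le> 2 * N"
    and s: "2 * N \<le> s * K ^ 2" and s': "4 * N \<le> s' * K" and T: "K * s + s' \<le> T"
  shows "exp (- 4 * real K) / 2 \<le> birth_prob (lower_rate N) H T 0"
proof -
  let ?\<rho> = "lower_rate N"
  have \<rho>: "?\<rho> k = rate k / (2 * N)" if "k < H" for k
  proof -
    have "real H ^ 2 \<le> 2 * N" using H by (metis of_nat_le_iff of_nat_mult of_nat_numeral of_nat_power)
    then have "rate k \<le> 2 * N" using rate_le_square[OF that] by linarith
    then show ?thesis using N by (simp add: lower_rate_def)
  qed
  have \<rho>_pos: "0 < ?\<rho> k" for k
    using rate_pos[of k] N by (simp add: lower_rate_def)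
  \<comment> \<open>The mean number of jumps \<open>s * ?\<rho> k\<close> is at least
    \<open>rate k / K ^ 2\<close>. One factor \<open>2\<close> is lost in
    \<open>one_minus_exp_ge\<close>, another in bounding \<open>(k + 1) ^ 2\<close> by
    \<open>2 * rate k\<close>.\<close>
  have factor: "(real (Suc k))\<^sup>2 / (4 * real K ^ 2) \<le> 1 - (1 - ?\<rho> k) ^ s" if "k < K" for k
  proof -
    define y where "y = rate k / real K ^ 2"
    have y: "0 \<le> y" "y \<le> 1"
      using rate_le_square[OF that] rate_pos[of k] K by (simp_all add: y_def)
    have "2 * real N \<le> real s * real K ^ 2"
      using s by (metis of_nat_le_iff of_nat_mult of_nat_numeral of_nat_power)
    then have "1 / real K ^ 2 \<le> real s / (2 * N)"
      using K N by (simp add: field_simps)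
    then have "rate k * (1 / real K ^ 2) \<le> rate k * (real s / (2 * N))"
      using rate_pos[of k] by (intro mult_left_mono) auto
    then have "y \<le> real s * ?\<rho> k"
      using \<rho>[of k] K that by (simp add: y_def mult.commute)
    have "(1 - ?\<rho> k) ^ s \<le> exp (- ?\<rho> k) ^ s"
      using exp_ge_add_one_self[of "- ?\<rho> k"] lower_rate_le_1 by (intro power_mono) auto
    also have "\<dots> = exp (- (real s * ?\<rho> k))"
      by (simp flip: exp_of_nat_mult)
    also have "\<dots> \<le> exp (- y)" using \<open>y \<le> real s * ?\<rho> k\<close> by simp
    also have "\<dots> \<le> 1 - y / 2" using one_minus_exp_ge[OF y] by simp
    finally have "y / 2 \<le> 1 - (1 - ?\<rho> k) ^ s" by simp
    moreover have "(real (Suc k))\<^sup>2 / (4 * real K ^ 2) \<le> y / 2"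
    proof -
      have "(real (Suc k))\<^sup>2 \<le> 2 * rate k"
        by (simp add: rate_def power2_eq_square algebra_simps)
      then show ?thesis using K by (simp add: y_def field_simps)
    qed
    ultimately show ?thesis by linarith
  qed
  \<comment> \<open>The product is the square of \<open>fact K / K ^ K\<close>, divided by
    \<open>4 ^ K\<close>. The weak Stirling bound costs \<open>exp (2 * K)\<close>, and
    \<open>4\<close> being at most \<open>exp 2\<close> costs the same again.\<close>
  have "exp (- 4 * real K) \<le> (\<Prod>k<K. (real (Suc k))\<^sup>2 / (4 * real K ^ 2))"
  proof -
    have e4: "(4::real) \<le> exp 2"
      using power_mono[OF exp_ge_add_one_self[of 1], of 2] by (simp flip: exp_double)
    have "(\<Prod>k<K. (real (Suc k))\<^sup>2 / (4 * real K ^ 2)) = (\<Prod>k<K. real (Suc k))\<^sup>2 / (4 * real K ^ 2) ^ K"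
      by (simp add: prod_dividef prod_power_distrib[symmetric])
    also have "(\<Prod>k<K. real (Suc k)) = fact K"
      by (simp add: fact_prod_Suc lessThan_atLeast0)
    also have "(4 * real K ^ 2) ^ K = 4 ^ K * (real K ^ K)\<^sup>2"
      by (simp add: power_mult_distrib mult.commute flip: power_mult)
    finally have eq: "(\<Prod>k<K. (real (Suc k))\<^sup>2 / (4 * real K ^ 2)) = (fact K)\<^sup>2 / (4 ^ K * (real K ^ K)\<^sup>2)" .
    have "4 ^ K * (real K ^ K)\<^sup>2 \<le> exp 2 ^ K * (fact K * exp (real K))\<^sup>2"
      using e4 by (intro mult_mono power_mono power_self_le_fact_exp) auto
    also have "\<dots> = (fact K)\<^sup>2 * exp (4 * real K)"
    proof -
      have "exp 2 ^ K * (exp (real K))\<^sup>2 = exp (4 * real K)"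
        unfolding exp_of_nat_mult[symmetric] exp_double[symmetric] exp_add[symmetric] by simp
      then show ?thesis by (simp only: power_mult_distrib mult.assoc mult.left_commute)
    qed
    finally have "exp (- 4 * real K) * (4 ^ K * (real K ^ K)\<^sup>2) \<le> exp (- 4 * real K) * ((fact K)\<^sup>2 * exp (4 * real K))"
      by (intro mult_left_mono) auto
    also have "\<dots> = (fact K)\<^sup>2"
      by (simp add: exp_minus)
    finally show ?thesis
      unfolding eq using K by (subst pos_le_divide_eq) auto
  qed
  also have "\<dots> \<le> (\<Prod>k<K. 1 - (1 - ?\<rho> k) ^ s)"
    using factor by (intro prod_mono) auto
  finally have prod: "exp (- 4 * real K) \<le> (\<Prod>k<K. 1 - (1 - ?\<rho> k) ^ s)" .
  \<comment> \<open>The mean time from \<open>K\<close> to \<open>H\<close> is at most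
    \<open>2 * N / K\<close>, that is, at most half of \<open>s'\<close>.\<close>
  have half: "1 / 2 \<le> birth_prob ?\<rho> H s' K"
  proof -
    have s'_pos: "0 < s'" using s' N K by (cases s') auto
    have "s' * (1 - birth_prob ?\<rho> H s' K) \<le> (\<Sum>j=K..<H. 1 / ?\<rho> j)"
      by (rule birth_prob_markov[OF lower_rate_nonneg lower_rate_le_1 \<rho>_pos])
    also have "\<dots> = (2 * N) * (\<Sum>j=K..<H. 1 / rate j)"
      by (simp add: sum_distrib_left \<rho>)
    also have "\<dots> \<le> (2 * N) * (1 / K)"
      by (intro mult_left_mono sum_inverse_rate_le K) auto
    also have "\<dots> \<le> s' / 2"
    proof -
      have "4 * real N \<le> real s' * real K" using s' by (metis of_nat_le_iff of_nat_mult of_nat_numeral)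
      then show ?thesis using K by (simp add: field_simps)
    qed
    finally show ?thesis using s'_pos by (simp add: field_simps)
  qed
  have "exp (- 4 * real K) * (1 / 2) \<le> (\<Prod>k<K. 1 - (1 - ?\<rho> k) ^ s) * birth_prob ?\<rho> H s' K"
    using prod half by (intro mult_mono order_trans[OF _ prod]) auto
  also have "\<dots> \<le> birth_prob ?\<rho> H (K * s + s') 0"
    by (rule birth_prob_block[OF lower_rate_nonneg lower_rate_le_1])
  also have "\<dots> \<le> birth_prob ?\<rho> H T 0"
    by (rule birth_prob_mono_time[OF lower_rate_nonneg lower_rate_le_1 T])
  finally show ?thesis by simp
qed

section \<open>The two phases of the growth\<close>

text \<open>Only an inequality, since it holds for every \<open>\<omega>\<close>, including the null
  set on which the hit column lies outside \<open>{1..N}\<close>.\<close>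

lemma sum_config_le: "(\<Sum>j=1..N. config N t \<omega> j) \<le> t"
proof (induction t)
  case (Suc t)
  define \<sigma> c where "\<sigma> = config N t \<omega>" and "c = hit_col N \<sigma> (\<omega> !! t)"
  have "(\<Sum>j=1..N. (\<sigma>(c := Suc (\<sigma> c))) j) \<le> (\<Sum>j=1..N. \<sigma> j + of_bool (j = c))"
    by (intro sum_mono) auto
  also have "\<dots> \<le> (\<Sum>j=1..N. \<sigma> j) + 1"
    by (simp add: sum.distrib of_bool_def)
  finally show ?case
    using Suc by (simp add: deposit_def \<sigma>_def c_def)
qed simp

text \<open>Columns below \<open>K\<close> are charged to the total height, the others to their
  number.\<close>

lemma cover_le:
  assumes "\<forall>j\<in>{1..N}. \<sigma> j < H"
  shows "cover N \<sigma> \<le> K * (\<Sum>j=1..N. \<sigma> j) + H ^ 2 * card {j\<in>{1..N}. K \<le> \<sigma> j}"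
proof -
  have "cover N \<sigma> \<le> (\<Sum>j=1..N. K * \<sigma> j + (if K \<le> \<sigma> j then H ^ 2 else 0))"
    unfolding cover_def
  proof (intro sum_mono)
    fix j assume "j \<in> {1..N}"
    then have "\<sigma> j * (\<sigma> j + 1) \<le> H ^ 2"
      unfolding power2_eq_square using assms by (intro mult_mono) (auto intro: less_imp_le Suc_leI)
    moreover have "\<sigma> j * (\<sigma> j + 1) \<le> K * \<sigma> j" if "\<sigma> j < K"
      using that by (subst mult.commute) (intro mult_mono, auto)
    ultimately show "\<sigma> j * (\<sigma> j + 1) \<le> K * \<sigma> j + (if K \<le> \<sigma> j then H ^ 2 else 0)"
      by auto
  qed
  also have "\<dots> = K * (\<Sum>j=1..N. \<sigma> j) + H ^ 2 * card {j\<in>{1..N}. K \<le> \<sigma> j}"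
    by (simp add: sum.distrib sum_distrib_left sum.If_cases Int_def mult.commute)
  finally show ?thesis .
qed

lemma one_add_power_le_exp: "0 \<le> 1 + x \<Longrightarrow> (1 + x) ^ n \<le> exp (n * x)" for x :: real
  unfolding exp_of_nat_mult by (intro power_mono exp_ge_add_one_self)

lemma divide_minus_1_le_div: "real a / real b - 1 \<le> real (a div b)"
  using real_of_int_floor_gt_diff_one[of "real a / real b"]
  unfolding floor_divide_of_nat_eq by simp

lemma prob_many_tall_le_exp:
  assumes N: "1 \<le> N" and K: "8 * K * t \<le> N" and \<theta>: "0 \<le> \<theta>"
  shows "measure (deposition_space N) {\<omega>. m \<le> card {j\<in>{1..N}. K \<le> config N t \<omega> j}}
    \<le> exp (real N * (\<theta> * exp (- real K))) / (1 + \<theta>) ^ m"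
proof -
  let ?u = "birth_prob (upper_rate N) K t 0"
  have "0 \<le> ?u"
    using birth_prob_nonneg_le_1[of "upper_rate N", OF upper_rate_nonneg upper_rate_le_1] by blast
  with \<theta> have "0 \<le> \<theta> * ?u" by simp
  have "(1 + \<theta>) ^ m * measure (deposition_space N) {\<omega>. m \<le> card {j\<in>{1..N}. K \<le> config N t \<omega> j}}
      \<le> (1 + \<theta> * ?u) ^ N"
    by (rule prob_many_tall_le[OF N \<theta>])
  also have "\<dots> \<le> exp (real N * (\<theta> * ?u))"
    using \<open>0 \<le> \<theta> * ?u\<close> by (intro one_add_power_le_exp) auto
  also have "\<dots> \<le> exp (real N * (\<theta> * exp (- real K)))"
    using \<theta> birth_prob_upper_rate_le[OF N K] by (simp add: mult_left_mono)
  finally show ?thesis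
    using \<theta> by (simp add: pos_le_divide_eq mult.commute)
qed

text \<open>The errors belong to a column reaching \<open>K1\<close> too early, to \<open>m\<close>
  columns reaching \<open>K2\<close> by time \<open>T\<close>, and to all columns staying below
  \<open>H\<close> although the cover is small.\<close>

lemma prob_good_ge:
  assumes N: "1 \<le> N" and K1: "8 * K1 * t \<le> N" and K2: "8 * K2 * T \<le> N" and m: "4 * H ^ 2 * m \<le> N"
    and K: "1 \<le> K" "K \<le> H" and H: "H ^ 2 \<le> 2 * N"
    and s: "2 * N \<le> s * K ^ 2" and s': "4 * N \<le> s' * K" and T: "K * s + s' \<le> T"
  shows "1 - (exp (real N * (real N ^ 2 * exp (- real K1))) / real N ^ 2 + exp (real N * (2 * exp (- real K2)) - real m)
      + exp (- (real N * (exp (- 4 * real K) / 2))))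
    \<le> measure (deposition_space N)
      {\<omega>. height_max N (config N t \<omega>) < K1 \<and> H \<le> height_max N (config N T \<omega>)}"
    (is "1 - (?e1 + ?e2 + ?e3) \<le> measure ?D ?good")
proof -
  interpret D: prob_space ?D by (rule prob_space_deposition_space)
  let ?B1 = "{\<omega>. 1 \<le> card {j\<in>{1..N}. K1 \<le> config N t \<omega> j}}"
  let ?B2 = "{\<omega>. m \<le> card {j\<in>{1..N}. K2 \<le> config N T \<omega> j}}"
  let ?B3 = "{\<omega>. 2 * cover N (config N T \<omega>) \<le> N \<and> (\<forall>j\<in>{1..N}. config N T \<omega> j < H)}"
  have max_less: "height_max N \<sigma> < k \<longleftrightarrow> (\<forall>j\<in>{1..N}. \<sigma> j < k)" for \<sigma> k
    unfolding height_max_def using N by (subst Max_less_iff) auto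
  have B1: "measure ?D ?B1 \<le> ?e1"
  proof -
    \<comment> \<open>Here \<open>\<theta> = N ^ 2\<close> and the count is \<open>1\<close>, which
      gives the summable denominator.\<close>
    have "measure ?D ?B1 \<le> exp (real N * (real N ^ 2 * exp (- real K1))) / (1 + real N ^ 2) ^ 1"
      by (rule prob_many_tall_le_exp[OF N K1]) simp
    also have "\<dots> \<le> ?e1"
      using N by (intro divide_left_mono mult_pos_pos zero_less_power add_pos_nonneg) auto
    finally show ?thesis .
  qed
  have B2: "measure ?D ?B2 \<le> ?e2"
  proof -
    have "measure ?D ?B2 \<le> exp (real N * (2 * exp (- real K2))) / (1 + 2 :: real) ^ m"
      by (rule prob_many_tall_le_exp[OF N K2]) simp
    also have "\<dots> \<le> exp (real N * (2 * exp (- real K2))) / exp 1 ^ m"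
      using exp_le by (intro divide_left_mono power_mono) auto
    also have "\<dots> = ?e2"
      by (simp add: exp_diff flip: exp_of_nat_mult)
    finally show ?thesis .
  qed
  have B3: "measure ?D ?B3 \<le> ?e3"
  proof -
    let ?w = "birth_prob (lower_rate N) H T 0"
    have "?w \<le> 1"
      using birth_prob_nonneg_le_1[of "lower_rate N", OF lower_rate_nonneg lower_rate_le_1] by blast
    have "measure ?D ?B3 \<le> (1 + - ?w) ^ N"
      using prob_all_short_le[OF N] by simp
    also have "\<dots> \<le> exp (real N * - ?w)"
      using \<open>?w \<le> 1\<close> by (intro one_add_power_le_exp) auto
    also have "\<dots> \<le> ?e3"
      using mult_left_mono[OF birth_prob_lower_rate_ge[OF K N H s s' T], of "real N"]
      unfolding mult_minus_right exp_le_cancel_iff neg_le_iff_le by simp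
    finally show ?thesis .
  qed
  \<comment> \<open>If all columns are below \<open>H\<close> at time \<open>T\<close> and fewer
    than \<open>m\<close> reach \<open>K2\<close>, then the cover is at most
    \<open>N / 8 + N / 4\<close>, so \<open>?B3\<close> occurs.\<close>
  have "- ?good \<subseteq> ?B1 \<union> (?B2 \<union> ?B3)"
  proof
    fix \<omega> assume bad: "\<omega> \<in> - ?good"
    show "\<omega> \<in> ?B1 \<union> (?B2 \<union> ?B3)"
    proof (cases "height_max N (config N t \<omega>) < K1")
      case False
      then obtain j where "j \<in> {1..N}" "K1 \<le> config N t \<omega> j"
        by (auto simp: max_less not_less)
      then have "{j\<in>{1..N}. K1 \<le> config N t \<omega> j} \<noteq> {}" by blast
      then have "0 < card {j\<in>{1..N}. K1 \<le> config N t \<omega> j}" by (subst card_gt_0_iff) auto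
      then show ?thesis by simp
    next
      case True
      then have short: "\<forall>j\<in>{1..N}. config N T \<omega> j < H"
        using bad by (auto simp: not_le max_less)
      show ?thesis
      proof (cases "m \<le> card {j\<in>{1..N}. K2 \<le> config N T \<omega> j}")
        case False
        have "cover N (config N T \<omega>) \<le> K2 * (\<Sum>j=1..N. config N T \<omega> j) +
            H ^ 2 * card {j\<in>{1..N}. K2 \<le> config N T \<omega> j}"
          by (rule cover_le[OF short])
        also have "\<dots> \<le> K2 * T + H ^ 2 * m"
          using False by (intro add_mono mult_left_mono sum_config_le) auto
        finally have "2 * cover N (config N T \<omega>) \<le> N"
          using K2 m by linarith
        with short show ?thesis by simp
      qed simp
    qed
  qed
  then have "measure ?D (- ?good) \<le> measure ?D (?B1 \<union> (?B2 \<union> ?B3))"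
    using sets_config by (intro D.finite_measure_mono sets.Un) auto
  also have "\<dots> \<le> measure ?D ?B1 + (measure ?D ?B2 + measure ?D ?B3)"
    using sets_config
    by (intro order_trans[OF measure_Un_le] add_left_mono measure_Un_le sets.Un) auto
  also have "\<dots> \<le> ?e1 + (?e2 + ?e3)"
    by (intro add_mono B1 B2 B3)
  finally have "measure ?D (- ?good) \<le> ?e1 + ?e2 + ?e3" by simp
  moreover have "?good \<in> sets ?D"
    using sets.Int[OF sets_config[of "\<lambda>\<sigma>. height_max N \<sigma> < K1" N t] sets_config[of "\<lambda>\<sigma>. H \<le> height_max N \<sigma>" N T]]
    by (simp add: Int_def)
  then have "measure ?D (- ?good) = 1 - measure ?D ?good"
    using D.prob_compl[of ?good] by (simp add: Compl_eq_Diff_UNIV)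
  ultimately show ?thesis by linarith
qed

lemma eventually_prob_good_ge:
  "\<forall>\<^sub>F N in sequentially. 1 - 5 / real N ^ 2 \<le> measure (deposition_space N)
     {\<omega>. real (height_max N (config N (nat \<lfloor>1 / 40 * real N / ln (real N)\<rfloor>) \<omega>)) \<le> 3 * ln (real N)
       \<and> real (height_max N (config N (nat \<lfloor>256 * real N / ln (real N)\<rfloor>) \<omega>)) \<ge> real N powr (1 / 8192)}"
proof -
  have "\<forall>\<^sub>F N::nat in sequentially. 1 \<le> N"
    by (rule eventually_ge_at_top)
  moreover have "\<forall>\<^sub>F N::nat in sequentially. 1 \<le> ln (real N)"
    by real_asymp
  moreover have "\<forall>\<^sub>F N::nat in sequentially. ln (real N) / 16 + 1 \<le> real N powr (1 / 8192)"
    by real_asymp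
  moreover have "\<forall>\<^sub>F N::nat in sequentially. (real N powr (1 / 8192) + 1) ^ 2 \<le> 2 * real N"
    by real_asymp
  moreover have "\<forall>\<^sub>F N::nat in sequentially. 2 * real N + (ln (real N) / 16 + 1) ^ 2 \<le> (256 * real N / ln (real N) - 1) * (ln (real N) / 16) / 2"
    by real_asymp
  moreover have "\<forall>\<^sub>F N::nat in sequentially. 4 * real N \<le> (256 * real N / ln (real N) - 1) * (ln (real N) / 16) / 2"
    by real_asymp
  \<comment> \<open>This fixes the exponent: the left side has order
    \<open>N powr (1 - 1 / 2048)\<close>, the right side order
    \<open>N powr (1 - 2 / 8192)\<close>.\<close>
  moreover have "\<forall>\<^sub>F N::nat in sequentially. real N * (2 * exp (- (ln (real N) / 2048 - 1))) + 2 * ln (real N)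
      \<le> real N / (4 * (real N powr (1 / 8192) + 1) ^ 2) - 1"
    by real_asymp
  moreover have "\<forall>\<^sub>F N::nat in sequentially. 2 * ln (real N) \<le> real N * (exp (- 4 * (ln (real N) / 16 + 1)) / 2)"
    by real_asymp
  ultimately show ?thesis
  proof eventually_elim
    case (elim N)
    define L where "L = ln (real N)"
    define t T where "t = nat \<lfloor>1 / 40 * real N / L\<rfloor>" and "T = nat \<lfloor>256 * real N / L\<rfloor>"
    \<comment> \<open>\<open>K1\<close> exceeds the floor by one, so that a height below it is at
      most \<open>3 * L\<close>. \<open>K2\<close> is chosen with \<open>8 * 256 / 2048 = 1\<close>.
      With \<open>K\<close> near \<open>L / 16\<close>, the climbing cost
      \<open>exp (- 4 * K)\<close> is only of order \<open>N powr (- 1 / 4)\<close>.\<close>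
    define K1 K2 K where "K1 = nat \<lfloor>3 * L\<rfloor> + 1" and "K2 = nat \<lfloor>L / 2048\<rfloor>" and "K = nat \<lceil>L / 16\<rceil>"
    define H where "H = nat \<lceil>real N powr (1 / 8192)\<rceil>"
    \<comment> \<open>At most half of the time \<open>T\<close> goes to the climb and the rest to
      the explosion. Since \<open>T * K / 2\<close> is about \<open>8 * N\<close>, both requirements
      hold with room for rounding.\<close>
    define m s s' where "m = N div (4 * H ^ 2)" and "s = T div (2 * K)" and "s' = T - K * s"
    note elim = elim[folded L_def]
    have N: "1 \<le> N" and L: "1 \<le> L" using elim by auto
    have expL: "exp L = N" using N by (simp add: L_def)
    have t: "real t \<le> 1 / 40 * real N / L" and T_le: "real T \<le> 256 * real N / L"
      using L by (simp_all add: t_def T_def)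
    have T_ge: "256 * real N / L - 1 \<le> real T"
      unfolding T_def by linarith
    have K1: "3 * L \<le> real K1" "real K1 \<le> 3 * L + 1"
      using L unfolding K1_def by linarith+
    have K2: "real K2 \<le> L / 2048" "L / 2048 - 1 \<le> real K2"
      using L unfolding K2_def by linarith+
    have K: "L / 16 \<le> real K" "real K \<le> L / 16 + 1"
      using L unfolding K_def by linarith+
    have H: "real N powr (1 / 8192) \<le> real H" "real H \<le> real N powr (1 / 8192) + 1"
      unfolding H_def using powr_ge_zero[of "real N" "1 / 8192"] by linarith+
    have K_pos: "0 < K" using K L by (cases K) auto
    have H_pos: "0 < H" using H N by (cases H) auto
    have TK: "(256 * real N / L - 1) * (L / 16) / 2 \<le> real T * real K / 2"
      using T_ge K L N by (intro divide_right_mono mult_mono) auto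

    have c1: "8 * K1 * t \<le> N"
    proof -
      have "real (8 * K1 * t) \<le> 8 * (5 * L) * (1 / 40 * real N / L)"
        unfolding of_nat_mult using t K1 L by (intro mult_mono) auto
      also have "\<dots> = N" using L by simp
      finally show ?thesis by linarith
    qed
    have c2: "8 * K2 * T \<le> N"
    proof -
      have "real (8 * K2 * T) \<le> 8 * (L / 2048) * (256 * real N / L)"
        unfolding of_nat_mult using T_le K2 L by (intro mult_mono) auto
      also have "\<dots> = N" using L by simp
      finally show ?thesis by linarith
    qed
    have c3: "4 * H ^ 2 * m \<le> N"
      unfolding m_def by (rule times_div_less_eq_dividend)
    have c4: "1 \<le> K" "K \<le> H"
      using K_pos K H elim by linarith+
    have c5: "H ^ 2 \<le> 2 * N"
    proof -
      have "real H ^ 2 \<le> (real N powr (1 / 8192) + 1) ^ 2"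
        using H by (intro power_mono) auto
      also have "\<dots> \<le> 2 * real N" using elim by simp
      finally have "real (H ^ 2) \<le> real (2 * N)" by simp
      then show ?thesis by linarith
    qed
    have c6: "2 * N \<le> s * K ^ 2"
    proof -
      have "real T / real (2 * K) - 1 \<le> real s"
        unfolding s_def using divide_minus_1_le_div[of T "2 * K"] .
      then have "(real T / real (2 * K) - 1) * real K ^ 2 \<le> real s * real K ^ 2"
        by (intro mult_right_mono) auto
      moreover have "(real T / real (2 * K) - 1) * real K ^ 2 = real T * real K / 2 - real K ^ 2"
        using K_pos by (simp add: field_simps power2_eq_square)
      moreover have "real K ^ 2 \<le> (L / 16 + 1) ^ 2"
        using K by (intro power_mono) auto
      ultimately have "2 * real N \<le> real s * real K ^ 2"
        using TK elim(5) by linarith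
      then have "real (2 * N) \<le> real (s * K ^ 2)" by simp
      then show ?thesis by linarith
    qed
    have Ks: "2 * (K * s) \<le> T"
      using times_div_less_eq_dividend[of "2 * K" T] unfolding s_def by (simp add: mult.assoc)
    have c7: "4 * N \<le> s' * K"
    proof -
      have "real T / 2 \<le> real s'" unfolding s'_def using Ks by linarith
      then have "real T * real K / 2 \<le> real s' * real K"
        using mult_right_mono[of "real T / 2" "real s'" "real K"] by simp
      then have "4 * real N \<le> real s' * real K"
        using TK elim(6) by linarith
      then have "real (4 * N) \<le> real (s' * K)" by simp
      then show ?thesis by linarith
    qed
    have c8: "K * s + s' \<le> T" using Ks by (simp add: s'_def)

    have inv: "exp (- (2 * L)) = 1 / real N ^ 2"
    proof -
      have "exp (2 * L) = real N ^ 2" unfolding exp_double expL ..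
      then show ?thesis by (simp add: exp_minus divide_inverse)
    qed
    \<comment> \<open>\<open>N ^ 3 * exp (- K1)\<close> is at most \<open>1\<close>, so the
      numerator is at most \<open>exp 1\<close>; together the errors have constant
      \<open>3 + 1 + 1 = 5\<close>.\<close>
    have e1: "exp (real N * (real N ^ 2 * exp (- real K1))) / real N ^ 2 \<le> 3 / real N ^ 2"
    proof -
      have "real N * (real N ^ 2 * exp (- real K1)) \<le> real N * (real N ^ 2 * exp (- (3 * L)))"
        using K1 by (intro mult_left_mono) auto
      also have "exp (- (3 * L)) = 1 / real N ^ 3"
      proof -
        have "exp (3 * L) = real N ^ 3" using exp_of_nat_mult[of 3 L] expL by simp
        then show ?thesis by (simp add: exp_minus divide_inverse)
      qed
      also have "real N * (real N ^ 2 * (1 / real N ^ 3)) = 1"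
        using N by (simp add: power2_eq_square power3_eq_cube)
      finally have "exp (real N * (real N ^ 2 * exp (- real K1))) \<le> exp 1" by simp
      from order_trans[OF this exp_le] show ?thesis
        by (rule divide_right_mono) simp
    qed
    have e2: "exp (real N * (2 * exp (- real K2)) - real m) \<le> 1 / real N ^ 2"
    proof -
      have "real N * (2 * exp (- real K2)) \<le> real N * (2 * exp (- (L / 2048 - 1)))"
        using K2 by (intro mult_left_mono) auto
      moreover have "real N / (4 * (real N powr (1 / 8192) + 1) ^ 2) \<le> real N / (4 * real H ^ 2)"
        using H H_pos by (intro divide_left_mono mult_left_mono power_mono mult_pos_pos zero_less_power) auto
      moreover have "real N / (4 * real H ^ 2) - 1 \<le> real m"
        unfolding m_def using divide_minus_1_le_div[of N "4 * H ^ 2"] by simp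
      ultimately have "real N * (2 * exp (- real K2)) - real m \<le> - (2 * L)"
        using elim by linarith
      then show ?thesis unfolding inv[symmetric] by simp
    qed
    have e3: "exp (- (real N * (exp (- 4 * real K) / 2))) \<le> 1 / real N ^ 2"
    proof -
      have "real N * (exp (- 4 * (L / 16 + 1)) / 2) \<le> real N * (exp (- 4 * real K) / 2)"
        using K by (intro mult_left_mono divide_right_mono) auto
      then have "- (real N * (exp (- 4 * real K) / 2)) \<le> - (2 * L)"
        using elim by linarith
      then show ?thesis unfolding inv[symmetric] by simp
    qed
    interpret D: prob_space "deposition_space N" by (rule prob_space_deposition_space)
    have "1 - 5 / real N ^ 2 \<le> 1 - (exp (real N * (real N ^ 2 * exp (- real K1))) / real N ^ 2 + exp (real N * (2 * exp (- real K2)) - real m)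
        + exp (- (real N * (exp (- 4 * real K) / 2))))"
      using add_mono[OF add_mono[OF e1 e2] e3] by (simp add: add_divide_distrib[symmetric])
    also have "\<dots> \<le> measure (deposition_space N)
        {\<omega>. height_max N (config N t \<omega>) < K1 \<and> H \<le> height_max N (config N T \<omega>)}"
      by (rule prob_good_ge[OF N c1 c2 c3 c4 c5 c6 c7 c8])
    also have "\<dots> \<le> measure (deposition_space N)
        {\<omega>. real (height_max N (config N t \<omega>)) \<le> 3 * L \<and> real (height_max N (config N T \<omega>)) \<ge> real N powr (1 / 8192)}"
    proof (rule D.finite_measure_mono)
      have "real h \<le> 3 * L" if "h < K1" for h
      proof -
        have "h \<le> nat \<lfloor>3 * L\<rfloor>" using that by (simp add: K1_def)
        then show ?thesis using L by linarith
      qed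
      moreover have "real N powr (1 / 8192) \<le> real h" if "H \<le> h" for h
        using that H(1) by linarith
      ultimately show "{\<omega>. height_max N (config N t \<omega>) < K1 \<and> H \<le> height_max N (config N T \<omega>)} \<subseteq>
          {\<omega>. real (height_max N (config N t \<omega>)) \<le> 3 * L \<and> real (height_max N (config N T \<omega>)) \<ge> real N powr (1 / 8192)}"
        by blast
      show "{\<omega>. real (height_max N (config N t \<omega>)) \<le> 3 * L \<and> real (height_max N (config N T \<omega>)) \<ge> real N powr (1 / 8192)}
          \<in> sets (deposition_space N)"
        using sets.Int[OF sets_config[of "\<lambda>\<sigma>. real (height_max N \<sigma>) \<le> 3 * L" N t]
          sets_config[of "\<lambda>\<sigma>. real (height_max N \<sigma>) \<ge> real N powr (1 / 8192)" N T]]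
        by (simp add: Int_def)
    qed
    finally show ?case by (simp add: t_def T_def L_def)
  qed
qed

theorem theorem1p1:
  shows "\<exists>(\<alpha>::real) (\<beta>::real) (c::real). \<exists>\<epsilon> :: nat \<Rightarrow> real.
    0 < \<alpha> \<and> \<alpha> < \<beta> \<and> 0 < c \<and> (\<forall>N. 0 \<le> \<epsilon> N) \<and> summable \<epsilon> \<and>
    (\<forall>N::nat. N \<ge> 2 \<longrightarrow>
       measure (deposition_space N)
         {\<omega> \<in> space (deposition_space N).
            real (height_max N (config N (nat \<lfloor>\<alpha> * real N / ln (real N)\<rfloor>) \<omega>)) \<le> 3 * ln (real N)
          \<and> real (height_max N (config N (nat \<lfloor>\<beta> * real N / ln (real N)\<rfloor>) \<omega>)) \<ge> real N powr c}
       \<ge> 1 - \<epsilon> N)"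
proof -
  let ?P = "\<lambda>N. measure (deposition_space N)
     {\<omega>. real (height_max N (config N (nat \<lfloor>1 / 40 * real N / ln (real N)\<rfloor>) \<omega>)) \<le> 3 * ln (real N)
       \<and> real (height_max N (config N (nat \<lfloor>256 * real N / ln (real N)\<rfloor>) \<omega>)) \<ge> real N powr (1 / 8192)}"
  obtain N0 where N0: "1 - 5 / real N ^ 2 \<le> ?P N" if "N0 \<le> N" for N
    using eventually_prob_good_ge unfolding eventually_sequentially by blast
  \<comment> \<open>The value \<open>1\<close> makes the claim trivial for the finitely many small
    \<open>N\<close> and does not affect summability.\<close>
  define \<epsilon> where "\<epsilon> N = (if N0 \<le> N then 5 / real N ^ 2 else 1)" for N
  have "summable (\<lambda>N. 5 / real N ^ 2)"
    using summable_mult[OF inverse_power_summable[of 2, where 'a = real], of 5]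
    by (simp add: divide_inverse)
  then have "summable \<epsilon>"
    by (subst summable_cong[of \<epsilon> "\<lambda>N. 5 / real N ^ 2"])
      (auto simp: \<epsilon>_def eventually_sequentially)
  moreover have "1 - \<epsilon> N \<le> ?P N" for N
    using N0[of N] by (simp add: \<epsilon>_def)
  ultimately show ?thesis
    by (intro exI[of _ "1 / 40"] exI[of _ 256] exI[of _ "1 / 8192"] exI[of _ \<epsilon>])
      (auto simp: \<epsilon>_def)
qed

end
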